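(* Let $G$ be a non-trivial finite group which is not a nice group. Then there exist finite free $G$-simplicial complexes $\mathcal{K}_1,\mathcal{K}_2$ such that $\operatorname{ind}\mathcal{K}_1=\operatorname{ind}\mathcal{K}_2=1$ but $\operatorname{ind}(\mathcal{K}_1\times\mathcal{K}_2)=0$, where $\mathcal{K}_1\times\mathcal{K}_2$ is the Cartesian product of (the geometric realizations of) the complexes with the diagonal action $g\cdot(x,y)=(gx,gy)$.
   Context: A finite group $G$ is called nice if it is either a cyclic $p$-group (for some prime $p$) or a generalized quaternion group $Q_{4n}=\langle a,b : a^n=b^2, a^{2n}=1, b^{-1}ab=a^{-1}\rangle$ ($n\ge 2$) whose order is a power of $2$. For a space $X$ with a free action of $G$, the mapping index $\operatorname{ind}X$ is the minimal $k\ge 0$ such that there is a continuous $G$-equivariant map $X\to E_kG$, where $E_kG=G^{*(k+1)}$ is the $(k+1)$-fold join of the discrete space $G$ with the natural $G$-action. A free $G$-simplicial complex is a simplicial complex with a simplicial $G$-action that is free on its geometric realization. *)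

theory Defs
  imports
    "HOL-Algebra.Group_Action"
    "HOL-Algebra.Elementary_Groups"
    "HOL-Homology.Simplices"
    "HOL-Library.Extended_Nat"
    "HOL-Computational_Algebra.Primes"
begin

section \<open>Groups given by generators and relations\<close>

text \<open>A letter \<open>(x, True)\<close> stands for the generator \<open>x\<close> and \<open>(x, False)\<close> for its formal inverse;
  a pair \<open>(u, v) \<in> R\<close> is the relation \<open>u = v\<close>.\<close>

type_synonym 'x word = "('x \<times> bool) list"

inductive word_eq :: "('x word \<times> 'x word) set \<Rightarrow> 'x word \<Rightarrow> 'x word \<Rightarrow> bool"
  for R where
  refl: "word_eq R u u"
| sym: "word_eq R u v \<Longrightarrow> word_eq R v u"
| trans: "word_eq R u v \<Longrightarrow> word_eq R v w \<Longrightarrow> word_eq R u w"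
| append: "word_eq R u u' \<Longrightarrow> word_eq R v v' \<Longrightarrow> word_eq R (u @ v) (u' @ v')"
| cancel: "word_eq R [(x, e), (x, \<not> e)] []"
| relation: "(u, v) \<in> R \<Longrightarrow> word_eq R u v"

definition word_class :: "('x word \<times> 'x word) set \<Rightarrow> 'x word \<Rightarrow> 'x word set" where
  "word_class R u = {v. word_eq R u v}"

definition presented_group :: "('x word \<times> 'x word) set \<Rightarrow> 'x word set monoid" where
  "presented_group R =
    \<lparr>carrier = range (word_class R),
     monoid.mult = (\<lambda>A B. \<Union>u\<in>A. \<Union>v\<in>B. word_class R (u @ v)),
     one = word_class R []\<rparr>"

lemma word_class_eq_iff: "word_class R u = word_class R v \<longleftrightarrow> word_eq R u v"
proof
  assume "word_class R u = word_class R v"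
  then show "word_eq R u v"
    using word_eq.refl[of R v] by (auto simp: word_class_def)
next
  assume "word_eq R u v"
  then show "word_class R u = word_class R v"
    unfolding word_class_def by (blast intro: word_eq.sym word_eq.trans)
qed

lemma mult_word_class:
  "word_class R u \<otimes>\<^bsub>presented_group R\<^esub> word_class R v = word_class R (u @ v)"
proof -
  have "word_class R (u' @ v') = word_class R (u @ v)"
    if "word_eq R u u'" "word_eq R v v'" for u' v'
    unfolding word_class_eq_iff by (rule word_eq.sym[OF word_eq.append[OF that]])
  then have "word_class R (u' @ v') = word_class R (u @ v)"
    if "u' \<in> word_class R u" "v' \<in> word_class R v" for u' v'
    using that by (simp add: word_class_def)
  moreover have "u \<in> word_class R u" "v \<in> word_class R v"
    by (simp_all add: word_class_def word_eq.refl)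
  ultimately have "(\<Union>u'\<in>word_class R u. \<Union>v'\<in>word_class R v. word_class R (u' @ v'))
      = word_class R (u @ v)"
    by blast
  then show ?thesis
    by (simp add: presented_group_def)
qed

lemma word_eq_inverse: "word_eq R (rev (map (\<lambda>(x, e). (x, \<not> e)) u) @ u) []"
proof (induction u)
  case Nil
  then show ?case by (simp add: word_eq.refl)
next
  case (Cons l u)
  obtain x e where l: "l = (x, e)" by (cases l)
  let ?w = "rev (map (\<lambda>(x, e). (x, \<not> e)) u)"
  have "word_eq R [(x, \<not> e), (x, e)] []"
    using word_eq.cancel[of R x "\<not> e"] by simp
  then have "word_eq R (?w @ ([(x, \<not> e), (x, e)] @ u)) (?w @ ([] @ u))"
    by (intro word_eq.append word_eq.refl)
  then show ?case
    using word_eq.trans[OF _ Cons.IH] by (simp add: l)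
qed

lemma group_presented_group: "group (presented_group R)"
proof (rule groupI)
  show "\<exists>y\<in>carrier (presented_group R). y \<otimes>\<^bsub>presented_group R\<^esub> x = \<one>\<^bsub>presented_group R\<^esub>"
    if x: "x \<in> carrier (presented_group R)" for x
  proof -
    obtain u where u: "x = word_class R u"
      using x by (auto simp: presented_group_def)
    let ?y = "word_class R (rev (map (\<lambda>(x, e). (x, \<not> e)) u))"
    have "?y \<otimes>\<^bsub>presented_group R\<^esub> x = word_class R []"
      unfolding u mult_word_class word_class_eq_iff by (rule word_eq_inverse)
    then show ?thesis by (auto simp: presented_group_def)
  qed
next
  fix x y z
  assume "x \<in> carrier (presented_group R)" "y \<in> carrier (presented_group R)"
    "z \<in> carrier (presented_group R)"
  then obtain u v w where
    *: "x = word_class R u" "y = word_class R v" "z = word_class R w"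
    by (auto simp: presented_group_def)
  show "x \<otimes>\<^bsub>presented_group R\<^esub> y \<in> carrier (presented_group R)"
    unfolding * mult_word_class by (simp add: presented_group_def)
  show "x \<otimes>\<^bsub>presented_group R\<^esub> y \<otimes>\<^bsub>presented_group R\<^esub> z
      = x \<otimes>\<^bsub>presented_group R\<^esub> (y \<otimes>\<^bsub>presented_group R\<^esub> z)"
    unfolding * mult_word_class by simp
next
  fix x assume "x \<in> carrier (presented_group R)"
  then obtain u where u: "x = word_class R u"
    by (auto simp: presented_group_def)
  have one: "\<one>\<^bsub>presented_group R\<^esub> = word_class R []"
    by (simp add: presented_group_def)
  show "\<one>\<^bsub>presented_group R\<^esub> \<otimes>\<^bsub>presented_group R\<^esub> x = x"
    unfolding u one mult_word_class by simp
qed (auto simp: presented_group_def)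

section \<open>Nice groups\<close>

datatype quat_gen = Gen_a | Gen_b

definition quat_relations :: "nat \<Rightarrow> (quat_gen word \<times> quat_gen word) set" where
  "quat_relations n =
    {(replicate n (Gen_a, True), replicate 2 (Gen_b, True)),
     (replicate (2 * n) (Gen_a, True), []),
     ([(Gen_b, False), (Gen_a, True), (Gen_b, True)], [(Gen_a, False)])}"

text \<open>\<open>generalized_quaternion n\<close> is the group usually denoted $Q_{4n}$.\<close>

definition generalized_quaternion :: "nat \<Rightarrow> quat_gen word set monoid" where
  "generalized_quaternion n = presented_group (quat_relations n)"

definition nice_group :: "('a, 'b) monoid_scheme \<Rightarrow> bool" where
  "nice_group G \<longleftrightarrow> group G \<and> finite (carrier G) \<and>
     ((cyclic_group G \<and> (\<exists>p m. prime (p::nat) \<and> order G = p ^ m)) \<or>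
      (\<exists>n\<ge>2. G \<cong> generalized_quaternion n \<and> (\<exists>m. order G = 2 ^ m)))"

section \<open>Joins and the spaces $E_k G$\<close>

definition quotient_topology :: "'x topology \<Rightarrow> ('x \<Rightarrow> 'y) \<Rightarrow> 'y topology" where
  "quotient_topology X q =
    topology (\<lambda>U. U \<subseteq> q ` topspace X \<and> openin X {x \<in> topspace X. q x \<in> U})"

lemma openin_quotient_topology:
  "openin (quotient_topology X q) U \<longleftrightarrow>
    U \<subseteq> q ` topspace X \<and> openin X {x \<in> topspace X. q x \<in> U}"
proof -
  have "istopology (\<lambda>U. U \<subseteq> q ` topspace X \<and> openin X {x \<in> topspace X. q x \<in> U})"
    unfolding istopology_def
  proof (intro conjI allI impI)
    fix S T
    assume "S \<subseteq> q ` topspace X \<and> openin X {x \<in> topspace X. q x \<in> S}"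
      "T \<subseteq> q ` topspace X \<and> openin X {x \<in> topspace X. q x \<in> T}"
    moreover have "{x \<in> topspace X. q x \<in> S \<inter> T}
        = {x \<in> topspace X. q x \<in> S} \<inter> {x \<in> topspace X. q x \<in> T}" by auto
    ultimately show "S \<inter> T \<subseteq> q ` topspace X" "openin X {x \<in> topspace X. q x \<in> S \<inter> T}"
      by auto
  next
    fix \<K>
    assume K: "\<forall>S\<in>\<K>. S \<subseteq> q ` topspace X \<and> openin X {x \<in> topspace X. q x \<in> S}"
    then show "\<Union>\<K> \<subseteq> q ` topspace X" by blast
    have "{x \<in> topspace X. q x \<in> \<Union>\<K>} = (\<Union>S\<in>\<K>. {x \<in> topspace X. q x \<in> S})" by auto
    then show "openin X {x \<in> topspace X. q x \<in> \<Union>\<K>}" using K by auto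
  qed
  then show ?thesis by (simp add: quotient_topology_def)
qed

lemma topspace_quotient_topology: "topspace (quotient_topology X q) = q ` topspace X"
proof -
  have "{x \<in> topspace X. q x \<in> q ` topspace X} = topspace X" by blast
  then have "openin (quotient_topology X q) (q ` topspace X)"
    by (simp add: openin_quotient_topology)
  then show ?thesis
    using openin_quotient_topology[of X q "topspace (quotient_topology X q)"] openin_subset
    by fastforce
qed

lemma quotient_map_quotient_topology: "quotient_map X (quotient_topology X q) q"
  unfolding quotient_map_def
  by (auto simp: topspace_quotient_topology openin_quotient_topology)

text \<open>A point of the \<open>(k+1)\<close>-fold join is a formal convex combination
  $t_0 x_0 \oplus \dots \oplus t_k x_k$ in which the entry $x_i$ is disregarded when $t_i = 0$.
  The identification is made by the map \<open>(t, x) \<mapsto> (t, restrict x {i. 0 < t i})\<close>,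
  which forgets exactly the entries with $t_i = 0$.\<close>

definition join_power ::
    "'x topology \<Rightarrow> nat \<Rightarrow> ((nat \<Rightarrow> real) \<times> (nat \<Rightarrow> 'x)) topology" where
  "join_power X k =
    quotient_topology
      (prod_topology (subtopology (powertop_real UNIV) (standard_simplex k))
                     (product_topology (\<lambda>_. X) {..k}))
      (\<lambda>(t, x). (t, restrict x {i. 0 < t i}))"

definition E_space ::
    "('a, 'b) monoid_scheme \<Rightarrow> nat \<Rightarrow> ((nat \<Rightarrow> real) \<times> (nat \<Rightarrow> 'a)) topology" where
  "E_space G k = join_power (discrete_topology (carrier G)) k"

definition E_action ::
    "('a, 'b) monoid_scheme \<Rightarrow> 'a \<Rightarrow> (nat \<Rightarrow> real) \<times> (nat \<Rightarrow> 'a)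
      \<Rightarrow> (nat \<Rightarrow> real) \<times> (nat \<Rightarrow> 'a)" where
  "E_action G g = (\<lambda>(t, x). (t, \<lambda>i\<in>{i. 0 < t i}. g \<otimes>\<^bsub>G\<^esub> x i))"

section \<open>The mapping index\<close>

definition equivariant_map ::
    "('a, 'b) monoid_scheme \<Rightarrow> 'x topology \<Rightarrow> ('a \<Rightarrow> 'x \<Rightarrow> 'x)
      \<Rightarrow> 'y topology \<Rightarrow> ('a \<Rightarrow> 'y \<Rightarrow> 'y) \<Rightarrow> ('x \<Rightarrow> 'y) \<Rightarrow> bool" where
  "equivariant_map G X act Y act' f \<longleftrightarrow>
    continuous_map X Y f \<and>
    (\<forall>g\<in>carrier G. \<forall>x\<in>topspace X. f (act g x) = act' g (f x))"

text \<open>The value is \<open>\<infinity>\<close> if there is no equivariant map to any $E_k G$.\<close>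

definition mapping_index ::
    "('a, 'b) monoid_scheme \<Rightarrow> 'x topology \<Rightarrow> ('a \<Rightarrow> 'x \<Rightarrow> 'x) \<Rightarrow> enat" where
  "mapping_index G X act =
    Inf {enat k |k. \<exists>f. equivariant_map G X act (E_space G k) (E_action G) f}"

section \<open>Simplicial complexes with a group action\<close>

text \<open>Abstract simplicial complexes, given by their nonempty simplices; the vertex set of \<open>K\<close>
  is \<open>\<Union>K\<close>.\<close>

definition abstract_complex :: "'v set set \<Rightarrow> bool" where
  "abstract_complex K \<longleftrightarrow>
    (\<forall>s\<in>K. finite s \<and> s \<noteq> {}) \<and> (\<forall>s\<in>K. \<forall>s'. s' \<subseteq> s \<and> s' \<noteq> {} \<longrightarrow> s' \<in> K)"

text \<open>Points of the geometric realization are given by their barycentric coordinates.\<close>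

definition realization_points :: "'v set set \<Rightarrow> ('v \<Rightarrow> real) set" where
  "realization_points K =
    {t. (\<forall>v. 0 \<le> t v) \<and> {v. t v \<noteq> 0} \<in> K \<and> (\<Sum>v\<in>{v. t v \<noteq> 0}. t v) = 1}"

text \<open>For a finite complex, the only case used below, the topology inherited from the product
  topology is the usual topology of the realization as a compact polyhedron.\<close>

definition realization :: "'v set set \<Rightarrow> ('v \<Rightarrow> real) topology" where
  "realization K = subtopology (powertop_real UNIV) (realization_points K)"

text \<open>The affine extension to the realization of a simplicial map \<open>f\<close>, which sends
  $\sum_v t_v v$ to $\sum_v t_v f(v)$.\<close>

definition affine_extension ::
    "'v set set \<Rightarrow> ('v \<Rightarrow> 'w) \<Rightarrow> ('v \<Rightarrow> real) \<Rightarrow> ('w \<Rightarrow> real)" where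
  "affine_extension K f t = (\<lambda>w. \<Sum>v\<in>{v \<in> \<Union>K. f v = w}. t v)"

definition simplicial_action ::
    "('a, 'b) monoid_scheme \<Rightarrow> 'v set set \<Rightarrow> ('a \<Rightarrow> 'v \<Rightarrow> 'v) \<Rightarrow> bool" where
  "simplicial_action G K \<phi> \<longleftrightarrow>
    group_action G (\<Union>K) \<phi> \<and> (\<forall>g\<in>carrier G. \<forall>s\<in>K. \<phi> g ` s \<in> K)"

abbreviation realization_action ::
    "'v set set \<Rightarrow> ('a \<Rightarrow> 'v \<Rightarrow> 'v) \<Rightarrow> 'a \<Rightarrow> ('v \<Rightarrow> real) \<Rightarrow> ('v \<Rightarrow> real)" where
  "realization_action K \<phi> g \<equiv> affine_extension K (\<phi> g)"

definition free_on ::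
    "('a, 'b) monoid_scheme \<Rightarrow> 'x topology \<Rightarrow> ('a \<Rightarrow> 'x \<Rightarrow> 'x) \<Rightarrow> bool" where
  "free_on G X act \<longleftrightarrow>
    (\<forall>g\<in>carrier G. g \<noteq> \<one>\<^bsub>G\<^esub> \<longrightarrow> (\<forall>x\<in>topspace X. act g x \<noteq> x))"

definition finite_free_complex ::
    "('a, 'b) monoid_scheme \<Rightarrow> 'v set set \<Rightarrow> ('a \<Rightarrow> 'v \<Rightarrow> 'v) \<Rightarrow> bool" where
  "finite_free_complex G K \<phi> \<longleftrightarrow>
    abstract_complex K \<and> finite K \<and> simplicial_action G K \<phi> \<and>
    free_on G (realization K) (realization_action K \<phi>)"

definition diagonal_action ::
    "('a \<Rightarrow> 'x \<Rightarrow> 'x) \<Rightarrow> ('a \<Rightarrow> 'y \<Rightarrow> 'y) \<Rightarrow> 'a \<Rightarrow> 'x \<times> 'y \<Rightarrow> 'x \<times> 'y" where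
  "diagonal_action act act' g = (\<lambda>(x, y). (act g x, act' g y))"

end

theory Submission
  imports Defs "HOL-Algebra.Sylow" "HOL-Number_Theory.Residues"
begin

text \<open>A finite group fails to be nice exactly when it has nontrivial subgroups \<open>H\<^sub>1\<close>, \<open>H\<^sub>2\<close> all of
  whose conjugates meet trivially: two subgroups of different prime orders, or, in a \<open>p\<close>-group with
  more than one subgroup of order \<open>p\<close>, a central one and another one. The hard part is that
  a \<open>p\<close>-group with a single subgroup of order \<open>p\<close> is cyclic or generalized quaternion: a maximal
  normal cyclic subgroup \<open>A\<close> is its own centralizer, and an \<open>x\<close> outside \<open>A\<close> with \<open>x ^ p\<close> in \<open>A\<close>
  could be corrected by an element of \<open>A\<close> to an element of order \<open>p\<close>, unless \<open>p = 2\<close>, \<open>x\<close> inverts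
  \<open>A\<close>, and \<open>x\<^sup>2\<close> is the involution of \<open>A\<close>.

  The complex \<open>K\<^sub>i\<close> is the graph $G \times_{H_i} (H_i * H_i)$. It maps to $G * G$, and a map to \<open>G\<close>
  is impossible because a component of the graph contains several points of one orbit. The components
  of \<open>K\<^sub>1 \<times> K\<^sub>2\<close> are indexed by \<open>G/H\<^sub>1 \<times> G/H\<^sub>2\<close>, on which \<open>G\<close> acts freely.\<close>

section \<open>Arithmetic modulo prime powers\<close>

text \<open>Disjoint conjugates are a statement about stabilizers: in G/H1 x G/H2 the pair (k1 H1,
  k2 H2) is fixed exactly by the intersection of two conjugates, so the condition says that G acts
  freely on the pairs, and a free G-set maps equivariantly to G. In a p-group one of the two
  subgroups is taken central so that it has no other conjugates; distinct subgroups of order p meet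
  trivially anyway. Looking for an element of order p in the coset A x amounts to a linear
  congruence modulo p^n whose leading coefficient is 1 + k + ... + k^(p-1). For odd p this is p
  times a unit, and p also divides the constant term, so a solution exists. For p = 2 it is 1 + k,
  which can be divisible by a high power of 2; this is where the quaternion groups come from.
  Quaternion groups are defined by a presentation, so their order is not known beforehand. Bounding
  it from above by normal forms is enough, because the presented group surjects onto a group that
  attains the bound.\<close>

lemma geometric_sum_mod_square:
  fixes k :: int
  assumes "[k = 1] (mod int p)" and "odd p"
  shows "[(\<Sum>j<p. k ^ j) = int p] (mod (int p)\<^sup>2)"
proof -
  obtain c where k: "k = 1 + int p * c"
    using assms(1) by (metis cong_iff_lin cong_sym)
  \<comment> \<open>Binomial expansion to first order; all later terms carry the square of
    p.\<close>
  have pow: "[k ^ j = 1 + int j * (int p * c)] (mod (int p)\<^sup>2)" for j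
  proof (induction j)
    case (Suc j)
    have "[k ^ Suc j = (1 + int p * c) * (1 + int j * (int p * c))] (mod (int p)\<^sup>2)"
      unfolding power_Suc using Suc k by (intro cong_mult) auto
    also have "(1 + int p * c) * (1 + int j * (int p * c))
        = 1 + int (Suc j) * (int p * c) + (int p)\<^sup>2 * (int j * c\<^sup>2)"
      by (simp add: algebra_simps power2_eq_square)
    also have "[\<dots> = 1 + int (Suc j) * (int p * c)] (mod (int p)\<^sup>2)"
      by (simp add: cong_def)
    finally show ?case .
  qed simp
  have "[(\<Sum>j<p. k ^ j) = (\<Sum>j<p. 1 + int j * (int p * c))] (mod (int p)\<^sup>2)"
    by (intro cong_sum pow)
  also have "(\<Sum>j<p. 1 + int j * (int p * c)) = int p + (\<Sum>j<p. int j) * (int p * c)"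
    by (simp add: sum.distrib sum_distrib_right)
  \<comment> \<open>Oddness of p enters here: (p - 1)/2 is an integer, so the sum of the indices
    contributes a second factor p to the first-order terms.\<close>
  also have "(\<Sum>j<p. int j) = int p * ((int p - 1) div 2)"
  proof -
    have "2 * (\<Sum>j<n. int j) = int n * (int n - 1)" for n
      by (induction n) (auto simp: algebra_simps)
    moreover have "int p - 1 = 2 * ((int p - 1) div 2)"
      using assms(2) by simp
    ultimately have "2 * (\<Sum>j<p. int j) = 2 * (int p * ((int p - 1) div 2))"
      by (metis mult.left_commute)
    then show ?thesis by simp
  qed
  also have "int p + int p * ((int p - 1) div 2) * (int p * c)
      = int p + (int p)\<^sup>2 * (((int p - 1) div 2) * c)"
    by (simp add: power2_eq_square)
  also have "[\<dots> = int p] (mod (int p)\<^sup>2)"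
    by (simp add: cong_def)
  finally show ?thesis .
qed

text \<open>After division by p the coefficient u is invertible modulo p^n, which gives
  \<open>i = - m' * v\<close>. The solution is the exponent that corrects an element to one of order
  p.\<close>

lemma solve_linear_mod_prime_power:
  fixes p :: nat and u m :: int
  assumes "coprime u (int p)" and "int p dvd m"
  shows "\<exists>i. int (p ^ n) dvd i * (int p * u) + m"
proof -
  obtain m' where m: "m = int p * m'" using assms(2) by (auto elim: dvdE)
  have "coprime u (int (p ^ n))" using assms(1) by simp
  then obtain v where v: "[u * v = 1] (mod int (p ^ n))"
    using cong_solve_coprime_int by blast
  have "[u * v * (- m') + m' = 1 * (- m') + m'] (mod int (p ^ n))"
    by (intro cong_add cong_mult v cong_refl)
  then have "int (p ^ n) dvd u * v * (- m') + m'"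
    by (simp add: cong_0_iff)
  then have "int (p ^ n) dvd int p * (u * v * (- m') + m')"
    by (rule dvd_mult)
  also have "int p * (u * v * (- m') + m') = (- m' * v) * (int p * u) + m"
    by (simp add: m algebra_simps)
  finally show ?thesis by blast
qed

text \<open>Fermat's little theorem: k^p is congruent to k modulo p. The residue \<open>r\<close>
  transfers the question to natural numbers.\<close>

lemma cong_1_of_power_prime:
  fixes k :: int
  assumes "prime p" and "[k ^ p = 1] (mod int p)"
  shows "[k = 1] (mod int p)"
proof -
  define r where "r = nat (k mod int p)"
  have p: "p > 1" using assms(1) by (simp add: prime_gt_Suc_0_nat)
  have r: "int r = k mod int p" using p by (simp add: r_def)
  have kr: "[k = int r] (mod int p)" by (simp add: r)
  then have "[int r ^ p = 1] (mod int p)"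
    using assms(2) by (meson cong_pow cong_sym cong_trans)
  then have rp: "[r ^ p = 1] (mod p)"
    by (metis cong_int_iff of_nat_1 of_nat_power)
  then have "coprime r p"
    by (metis cong_imp_coprime cong_sym coprime_1_left coprime_power_left_iff p
        not_one_less_zero zero_less_iff_neq_zero)
  then have "\<not> p dvd r"
    using assms(1) p by (metis coprime_absorb_right nat_dvd_1_iff_1 less_irrefl)
  then have "[r ^ (p - 1) = 1] (mod p)"
    by (rule fermat_theorem[OF assms(1)])
  then have "[r * r ^ (p - 1) = r * 1] (mod p)"
    by (rule cong_scalar_left)
  moreover have "r * r ^ (p - 1) = r ^ p"
    using p by (cases p) auto
  ultimately have "[r = 1] (mod p)"
    using rp by (metis cong_sym cong_trans mult.right_neutral)
  then have "[int r = 1] (mod int p)"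
    by (metis cong_int_iff of_nat_1)
  then show ?thesis using kr cong_trans by blast
qed

text \<open>The arithmetic behind the search for an element of order \<open>p\<close>: if \<open>x\<close> acts on a cyclic group
  \<open>\<langle>a\<rangle>\<close> of order \<open>p ^ n\<close> by \<open>a \<mapsto> a ^ k\<close> and \<open>x ^ p = a ^ m\<close>, then
  \<open>(a ^ i x) ^ p = a ^ (i (1 + k + \<dots> + k ^ (p - 1)) + m)\<close>.\<close>

lemma unsolvable_imp_inversion:
  fixes k m :: int and p n :: nat
  assumes p: "prime p" and n: "n > 0"
    and kp: "int (p ^ n) dvd k ^ p - 1" and mk: "int (p ^ n) dvd m * (k - 1)"
    and pm: "int p dvd m" and k1: "\<not> int (p ^ n) dvd k - 1"
    and unsolv: "\<And>i. \<not> int (p ^ n) dvd i * (\<Sum>j<p. k ^ j) + m"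
  shows "p = 2 \<and> n \<ge> 2 \<and> 2 ^ n dvd k + 1 \<and> 2 ^ n dvd m - 2 ^ (n - 1)"
proof -
  \<comment> \<open>Since p divides m, a geometric sum that is p times a unit makes the congruence
    solvable. This excludes odd p and, for p = 2, the case that 4 divides k - 1.\<close>
  have no: False if "(\<Sum>j<p. k ^ j) = int p * u" "coprime u (int p)" for u
    using solve_linear_mod_prime_power[OF that(2) pm, of n] unsolv that(1) by auto
  have "int p dvd int (p ^ n)" using n by (simp add: dvd_power)
  then have "[k ^ p = 1] (mod int p)"
    using kp by (metis cong_iff_dvd_diff dvd_trans)
  then have kc: "[k = 1] (mod int p)"
    by (rule cong_1_of_power_prime[OF p])
  show ?thesis
  proof (cases "p = 2")
    case False
    then have "odd p" using p by (metis primes_dvd_imp_eq two_is_prime_nat)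
    then have "[(\<Sum>j<p. k ^ j) = int p] (mod (int p)\<^sup>2)"
      using geometric_sum_mod_square[OF kc] by blast
    then obtain c where c: "(\<Sum>j<p. k ^ j) = int p + (int p)\<^sup>2 * c"
      by (metis cong_iff_lin cong_sym)
    have "(\<Sum>j<p. k ^ j) = int p * (1 + int p * c)"
      by (simp add: c power2_eq_square algebra_simps)
    moreover have "coprime (1 + int p * c) (int p)"
      by (metis add.commute coprime_1_left coprime_iff_gcd_eq_1 gcd_add_mult gcd.commute mult.commute)
    ultimately show ?thesis using no by blast
  next
    case p2: True
    have S: "(\<Sum>j<p. k ^ j) = 1 + k"
      by (simp add: p2 numeral_2_eq_2)
    have "odd k" using kc by (simp add: p2 cong_iff_dvd_diff)
    have "\<not> 4 dvd k - 1"
    proof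
      assume "4 dvd k - 1"
      then obtain c where c: "k = 1 + 4 * c" by (metis add_diff_cancel_left' diff_add_cancel dvdE add.commute)
      have "(\<Sum>j<p. k ^ j) = int p * (1 + 2 * c)" unfolding S using c by (simp add: p2)
      moreover have "coprime (1 + 2 * c) (int p)" by (simp add: p2)
      ultimately show False using no by blast
    qed
    moreover obtain w where "k = 2 * w + 1"
      using \<open>odd k\<close> by (rule oddE)
    ultimately have w: "k = 1 + 2 * w" "odd w"
      by (auto elim!: evenE)
    obtain n' where n': "n = Suc n'" using n by (cases n) auto
    \<comment> \<open>As k - 1 = 2 w with w odd, cancelling k - 1 costs one factor 2: m and k + 1
      come out divisible by 2^(n-1), and the parities of the cofactors \<open>m1\<close> and
      \<open>k1\<close> remain to be settled.\<close>
    have cop: "coprime (2 ^ n') w" using w by simp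
    have "2 ^ n' dvd m * w"
      using mk by (simp add: p2 n' w mult.left_commute)
    then have "2 ^ n' dvd m" using cop coprime_dvd_mult_left_iff by blast
    then obtain m1 where m1: "m = 2 ^ n' * m1" by (auto elim: dvdE)
    have "k ^ p - 1 = (k + 1) * (k - 1)" by (simp add: p2 power2_eq_square algebra_simps)
    then have "2 ^ n' dvd (k + 1) * w"
      using kp by (simp add: p2 n' w mult.left_commute)
    then have "2 ^ n' dvd k + 1" using cop coprime_dvd_mult_left_iff by blast
    then obtain k1 where k1': "k + 1 = 2 ^ n' * k1" by (auto elim: dvdE)
    \<comment> \<open>The exponents 0 and 1 suffice: \<open>i = 0\<close> is no solution, so
      \<open>m1\<close> is odd; \<open>i = 1\<close> is none either, so \<open>k1 + m1\<close> is
      odd and \<open>k1\<close> is even.\<close>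
    have "odd m1"
    proof
      assume "even m1"
      then have "int (p ^ n) dvd 0 * (\<Sum>j<p. k ^ j) + m"
        by (auto simp: m1 n' p2 elim!: evenE)
      then show False using unsolv by blast
    qed
    moreover have "even k1"
    proof (rule ccontr)
      assume "odd k1"
      then have "2 * 2 ^ n' dvd 2 ^ n' * (k1 + m1)"
        using \<open>odd m1\<close> by (simp add: mult.commute)
      then have "int (p ^ n) dvd 1 * (\<Sum>j<p. k ^ j) + m"
        using k1' unfolding S by (simp add: p2 n' m1 algebra_simps)
      then show False using unsolv by blast
    qed
    moreover have "n' \<noteq> 0"
      using k1 \<open>odd k\<close> by (cases n') (auto simp: p2 n')
    moreover have "m - 2 ^ n' = 2 ^ n' * (m1 - 1)"
      by (simp add: m1 algebra_simps)
    ultimately show ?thesis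
      using p2 by (auto simp: n' k1' mult.commute)
  qed
qed

section \<open>Actions of p-groups\<close>

text \<open>Bijectivity of each \<open>\<phi> g\<close> comes from the inverse group element.
  Extensionality has to be asked for because \<open>BijGroup E\<close> consists of extensional
  functions.\<close>

lemma (in group) group_actionI:
  assumes ext: "\<And>g. g \<in> carrier G \<Longrightarrow> \<phi> g \<in> extensional E"
    and closed: "\<And>g x. g \<in> carrier G \<Longrightarrow> x \<in> E \<Longrightarrow> \<phi> g x \<in> E"
    and one: "\<And>x. x \<in> E \<Longrightarrow> \<phi> \<one> x = x"
    and mult: "\<And>g h x. g \<in> carrier G \<Longrightarrow> h \<in> carrier G \<Longrightarrow> x \<in> E \<Longrightarrow> \<phi> (g \<otimes> h) x = \<phi> g (\<phi> h x)"
  shows "group_action G E \<phi>"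
proof -
  have inv: "\<phi> (inv g) (\<phi> g x) = x" "\<phi> g (\<phi> (inv g) x) = x" if "g \<in> carrier G" "x \<in> E" for g x
    using that by (simp_all flip: mult add: one)
  have bij: "\<phi> g \<in> Bij E" if "g \<in> carrier G" for g
    using that
    by (auto simp: Bij_def ext closed inv intro!: bij_betwI[where g = "\<phi> (inv g)"])
  have "\<phi> (g \<otimes> h) = \<phi> g \<otimes>\<^bsub>BijGroup E\<^esub> \<phi> h" if "g \<in> carrier G" "h \<in> carrier G" for g h
    using that
    by (intro extensionalityI[where A = E])
      (auto simp: BijGroup_def bij ext mult compose_def)
  then have "\<phi> \<in> hom G (BijGroup E)"
    using bij by (auto simp: hom_def BijGroup_def)
  then show ?thesis
    by (simp add: group_action_def group_hom_def group_hom_axioms_def group_BijGroup is_group)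
qed

text \<open>Every orbit with more than one point has size divisible by p, so the number of fixed
  points is divisible by p and cannot be one.\<close>

lemma (in group_action) p_group_second_fixed_point:
  assumes p: "prime p" and ord: "order G = p ^ n" and fin: "finite E" and dvd: "p dvd card E"
    and x0: "x0 \<in> E" "\<And>g. g \<in> carrier G \<Longrightarrow> \<phi> g x0 = x0"
  obtains x where "x \<in> E" "x \<noteq> x0" "\<And>g. g \<in> carrier G \<Longrightarrow> \<phi> g x = x"
proof (rule ccontr)
  note that_x = that
  assume neg: "\<not> thesis"
  interpret group G using group_hom by (simp add: group_hom_def)
  let ?O = "orbits G E \<phi>"
  have fins: "finite ?O" "\<And>S. S \<in> ?O \<Longrightarrow> finite S"
    using fin by (auto simp: orbits_coverture intro: finite_UnionD finite_subset[of _ "\<Union>?O"])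
  have orb0: "orbit G \<phi> x0 = {x0}"
    using x0 one_closed by (force simp: orbit_def)
  have "{x0} \<in> ?O" using x0(1) orb0 unfolding orbits_def by fastforce
  have p_dvd: "p dvd card S" if S: "S \<in> ?O - {{x0}}" for S
  proof -
    obtain x where x: "x \<in> E" "S = orbit G \<phi> x" using S by (auto simp: orbits_def)
    have "card S dvd p ^ n"
      using orbit_stabilizer_theorem[OF x(1)] ord x(2) by (metis dvd_triv_left)
    then obtain i where i: "card S = p ^ i" using p divides_primepow_nat by blast
    have "x \<noteq> x0" using S x orb0 by auto
    then obtain g where g: "g \<in> carrier G" "\<phi> g x \<noteq> x"
      using that_x[OF x(1)] neg by metis
    have "x \<in> S" "\<phi> g x \<in> S" using x orbit_refl g(1) by (auto simp: orbit_def)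
    then have "card S \<noteq> 1" using g(2) by (auto simp: card_1_singleton_iff)
    then have "i \<noteq> 0" using i by (cases i) auto
    then show ?thesis using i by (simp add: dvd_power)
  qed
  have "card E = (\<Sum>S\<in>?O. card S)"
    using disjoint_sum[OF fin, of "\<lambda>_. 1 :: nat"] by (simp only: card_eq_sum)
  also have "\<dots> = card {x0} + (\<Sum>S\<in>?O - {{x0}}. card S)"
    by (rule sum.remove) (use fins \<open>{x0} \<in> ?O\<close> in auto)
  finally have "card E = 1 + (\<Sum>S\<in>?O - {{x0}}. card S)" by simp
  moreover have "p dvd (\<Sum>S\<in>?O - {{x0}}. card S)" by (rule dvd_sum) (rule p_dvd)
  ultimately have "p dvd 1" using dvd by (metis dvd_add_left_iff)
  then show False using p by (simp add: prime_nat_iff)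
qed

text \<open>Conjugation acts on C/A, whose size is a positive power of p, and fixes the coset A;
  hence it fixes another one. For A trivial and C = G this is the nontriviality of the
  center.\<close>

lemma (in group) central_modulo_normal:
  assumes p: "prime p" and ord: "order G = p ^ n"
    and A: "A \<lhd> G" and C: "C \<lhd> G" and AC: "A \<subset> C"
  obtains x where "x \<in> C - A" "\<And>g. g \<in> carrier G \<Longrightarrow> g \<otimes> x \<otimes> inv g \<in> A #> x"
proof -
  interpret A: normal A G by (rule A)
  interpret C: normal C G by (rule C)
  have fin: "finite (carrier G)"
    using ord p by (metis card.infinite not_prime_0 order_def power_eq_0_iff)
  define E where "E = (\<lambda>x. A #> x) ` C"
  define \<phi> where "\<phi> g = (\<lambda>S\<in>E. (\<lambda>h. g \<otimes> h \<otimes> inv g) ` S)" for g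
  have conj: "(\<lambda>h. g \<otimes> h \<otimes> inv g) ` (A #> x) = A #> (g \<otimes> x \<otimes> inv g)"
    if g: "g \<in> carrier G" and x: "x \<in> carrier G" for g x
  proof -
    have cancel: "g \<otimes> (inv g \<otimes> w) = w" if "w \<in> carrier G" for w
      using g that by (simp flip: m_assoc)
    have *: "g \<otimes> (a \<otimes> x) \<otimes> inv g = (g \<otimes> a \<otimes> inv g) \<otimes> (g \<otimes> x \<otimes> inv g)"
      if "a \<in> carrier G" for a
      using that g x by (simp add: m_assoc inv_solve_left)
    show ?thesis
    proof (intro equalityI subsetI)
      fix y assume "y \<in> (\<lambda>h. g \<otimes> h \<otimes> inv g) ` (A #> x)"
      then obtain a where "a \<in> A" "y = g \<otimes> (a \<otimes> x) \<otimes> inv g"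
        by (auto simp: r_coset_def)
      then show "y \<in> A #> (g \<otimes> x \<otimes> inv g)"
        using * A.inv_op_closed2[OF g] by (auto simp: r_coset_def)
    next
      fix y assume "y \<in> A #> (g \<otimes> x \<otimes> inv g)"
      then obtain a where a: "a \<in> A" "y = a \<otimes> (g \<otimes> x \<otimes> inv g)"
        by (auto simp: r_coset_def)
      have "y = g \<otimes> ((inv g \<otimes> a \<otimes> g) \<otimes> x) \<otimes> inv g"
        using a g x A.mem_carrier[OF a(1)] by (simp add: m_assoc cancel)
      then show "y \<in> (\<lambda>h. g \<otimes> h \<otimes> inv g) ` (A #> x)"
        using A.inv_op_closed1[OF g a(1)] by (auto simp: r_coset_def)
    qed
  qed
  have \<phi>: "\<phi> g (A #> x) = A #> (g \<otimes> x \<otimes> inv g)" if "g \<in> carrier G" "x \<in> C" for g x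
    using that conj C.subset by (auto simp: \<phi>_def E_def)
  have "group_action G E \<phi>"
  proof (rule group_actionI)
    show "\<phi> g \<in> extensional E" for g by (simp add: \<phi>_def)
    show "\<phi> g S \<in> E" if "g \<in> carrier G" "S \<in> E" for g S
      using that \<phi> C.inv_op_closed2 by (auto simp: E_def)
    show "\<phi> \<one> S = S" if "S \<in> E" for S
      using that \<phi> C.subset by (auto simp: E_def subset_iff)
    show "\<phi> (g \<otimes> h) S = \<phi> g (\<phi> h S)" if "g \<in> carrier G" "h \<in> carrier G" "S \<in> E" for g h S
      using that \<phi> C.inv_op_closed2 C.subset
      by (auto simp: E_def subset_iff m_assoc inv_mult_group)
  qed
  then interpret act: group_action G E \<phi> .
  interpret GC: group "G\<lparr>carrier := C\<rparr>" by (rule C.subgroup_is_group[OF is_group])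
  have "subgroup A (G\<lparr>carrier := C\<rparr>)"
    using AC A.subgroup_axioms C.subgroup_axioms subgroup_incl by blast
  then have "card (rcosets\<^bsub>G\<lparr>carrier := C\<rparr>\<^esub> A) * card A = card C"
    using GC.lagrange by (simp add: order_def)
  moreover have "rcosets\<^bsub>G\<lparr>carrier := C\<rparr>\<^esub> A = E"
    by (auto simp: RCOSETS_def E_def r_coset_def)
  ultimately have index: "card E * card A = card C" by simp
  have "card C dvd order G"
    using lagrange[OF C.subgroup_axioms] by (metis dvd_triv_right)
  then have "card E dvd p ^ n" using index ord by (metis dvd_mult_left)
  then obtain i where i: "card E = p ^ i" using p divides_primepow_nat by blast
  have "card A < card C"
    using AC fin C.subset by (meson finite_subset psubset_card_mono)
  then have "i \<noteq> 0" using index i by (metis mult_1 nat_neq_iff power_0)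
  then have dvd: "p dvd card E" using i by (simp add: dvd_power)
  have finE: "finite E" using fin C.subset by (auto simp: E_def intro: finite_subset)
  have A_in: "A \<in> E" using AC A.one_closed A.subset coset_mult_one
    unfolding E_def by (metis C.one_closed image_eqI)
  have A_fix: "\<phi> g A = A" if "g \<in> carrier G" for g
    using \<phi>[OF that C.one_closed] that A.subset by (simp add: coset_mult_one)
  obtain S where S: "S \<in> E" "S \<noteq> A" "\<And>g. g \<in> carrier G \<Longrightarrow> \<phi> g S = S"
    using act.p_group_second_fixed_point[OF p ord finE dvd A_in A_fix] by blast
  then obtain x where x: "x \<in> C" "S = A #> x" by (auto simp: E_def)
  have "x \<notin> A" using S(2) x A.rcos_const[OF is_group] by auto
  moreover have "g \<otimes> x \<otimes> inv g \<in> A #> x" if g: "g \<in> carrier G" for g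
  proof -
    have "A #> (g \<otimes> x \<otimes> inv g) = A #> x" using S(3)[OF g] \<phi>[OF g x(1)] x(2) by simp
    moreover have "g \<otimes> x \<otimes> inv g \<in> A #> (g \<otimes> x \<otimes> inv g)"
      using g x C.subset by (intro rcos_self A.subgroup_axioms) auto
    ultimately show ?thesis by simp
  qed
  ultimately show ?thesis using that x(1) by blast
qed

section \<open>Groups of prime power order with a unique subgroup of prime order\<close>

context group
begin

lemma inv_cancel:
  assumes "g \<in> carrier G" "w \<in> carrier G"
  shows "inv g \<otimes> (g \<otimes> w) = w" "g \<otimes> (inv g \<otimes> w) = w"
  using assms by (simp_all flip: m_assoc)

lemma mem_generate_singleton:
  "a \<in> carrier G \<Longrightarrow> y \<in> generate G {a} \<longleftrightarrow> (\<exists>i::int. y = a [^] i)"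
  by (auto simp: generate_pow)

lemma subgroup_generate_singleton: "a \<in> carrier G \<Longrightarrow> subgroup (generate G {a}) G"
  by (simp add: generate_is_subgroup)

lemma conj_int_pow:
  assumes "g \<in> carrier G" "a \<in> carrier G"
  shows "g \<otimes> a [^] (i::int) \<otimes> inv g = (g \<otimes> a \<otimes> inv g) [^] i"
proof -
  have "(\<lambda>h. g \<otimes> h \<otimes> inv g) \<in> hom G G"
    using assms(1) by (auto simp: hom_def m_assoc inv_cancel)
  then show ?thesis
    using Group.hom_int_pow[of "\<lambda>h. g \<otimes> h \<otimes> inv g" G G a i] assms is_group by simp
qed

text \<open>The chain x, x^p, x^(p^2), ... ends at the identity, so it has a last member before it
  enters A. This replaces an element outside A by one whose p-th power lies in A.\<close>

lemma pow_eventually_in_subgroup: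
  assumes ord: "order G = p ^ n" and A: "subgroup A G" and x: "x \<in> carrier G" "x \<notin> A"
  obtains j where "x [^] (p ^ j :: nat) \<notin> A" "x [^] (p ^ Suc j :: nat) \<in> A"
proof -
  have "x [^] (p ^ n) \<in> A"
    using pow_order_eq_1[OF x(1)] ord subgroup.one_closed[OF A] by simp
  moreover have "x [^] (p ^ 0) \<notin> A" using x by simp
  ultimately obtain j where "\<forall>i\<le>j. x [^] (p ^ i) \<notin> A" "x [^] (p ^ Suc j) \<in> A"
    using ex_least_nat_less[of "\<lambda>k. x [^] (p ^ k) \<in> A" n] by auto
  then show ?thesis using that by blast
qed

lemma mem_generate_coprime_pow:
  assumes "a \<in> carrier G" "coprime m (int (ord a))"
  shows "a \<in> generate G {a [^] m}"
proof -
  obtain v where v: "[m * v = 1] (mod int (ord a))"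
    using cong_solve_coprime_int[OF assms(2)] by blast
  have "(a [^] m) [^] v = a [^] (1::int)"
    unfolding int_pow_pow[OF assms(1)] using v
    by (subst int_pow_eq[OF assms(1)]) (simp add: cong_iff_dvd_diff dvd_diff_commute)
  then show ?thesis
    using assms(1) by (metis int_pow_1 int_pow_closed mem_generate_singleton)
qed

lemma pow_commute_int_pow:
  assumes "a \<in> carrier G" "x \<in> carrier G" and act: "x \<otimes> a \<otimes> inv x = a [^] (k::int)"
  shows "x [^] (n::nat) \<otimes> a [^] (i::int) = a [^] (k ^ n * i) \<otimes> x [^] n"
proof (induction n arbitrary: i)
  case (Suc n)
  have "x \<otimes> a [^] i = a [^] (k * i) \<otimes> x"
    using conj_int_pow[OF assms(2,1), of i] assms
    by (simp add: int_pow_pow inv_solve_right')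
  then have "x [^] Suc n \<otimes> a [^] i = x [^] n \<otimes> a [^] (k * i) \<otimes> x"
    using assms by (simp add: m_assoc)
  also have "\<dots> = a [^] (k ^ n * (k * i)) \<otimes> x [^] Suc n"
    using assms by (simp add: Suc m_assoc)
  finally show ?case by (simp add: ac_simps)
qed (use assms in simp)

text \<open>Each time x is moved past \<open>a [^] i\<close> the exponent is multiplied by k;
  collecting the powers of a produces the geometric sum.\<close>

lemma pow_semidirect:
  assumes "a \<in> carrier G" "x \<in> carrier G" and act: "x \<otimes> a \<otimes> inv x = a [^] (k::int)"
  shows "(a [^] (i::int) \<otimes> x) [^] (n::nat) = a [^] (i * (\<Sum>j<n. k ^ j)) \<otimes> x [^] n"
proof (induction n)
  case (Suc n)
  have "(a [^] i \<otimes> x) [^] Suc n = a [^] (i * (\<Sum>j<n. k ^ j)) \<otimes> (x [^] n \<otimes> a [^] i) \<otimes> x"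
    using assms by (simp add: Suc m_assoc)
  also have "\<dots> = a [^] (i * (\<Sum>j<n. k ^ j)) \<otimes> a [^] (k ^ n * i) \<otimes> x [^] Suc n"
    using assms by (simp add: pow_commute_int_pow[OF assms] m_assoc)
  also have "\<dots> = a [^] (i * (\<Sum>j<Suc n. k ^ j)) \<otimes> x [^] Suc n"
    using assms by (simp add: int_pow_mult distrib_left mult.commute)
  finally show ?case .
qed (use assms in simp)

end

section \<open>Finite p-groups whose elements of order p all lie in one cyclic subgroup\<close>

locale unique_prime_subgroup = group +
  fixes p N :: nat and z
  assumes prime: "prime p" and order: "order G = p ^ N"
    and z: "z \<in> carrier G" "ord z = p"
    and uniq: "\<And>y. y \<in> carrier G \<Longrightarrow> y [^] p = \<one> \<Longrightarrow> y \<in> generate G {z}"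
begin

lemma finite_carrier: "finite (carrier G)"
  using order prime by (metis card.infinite not_prime_0 order_def power_eq_0_iff)

lemma ord_prime_power:
  assumes "a \<in> carrier G"
  obtains n where "ord a = p ^ n"
  using ord_dvd_group_order[OF assms] order prime divides_primepow_nat that by metis

text \<open>A nontrivial cyclic p-group contains a subgroup of order p, which must be
  \<open>generate G {z}\<close>. All later contradictions take the form of a solution of y^p = 1
  outside a nontrivial cyclic subgroup.\<close>

lemma prime_torsion_in_generate:
  assumes a: "a \<in> carrier G" "a \<noteq> \<one>" and y: "y \<in> carrier G" "y [^] p = \<one>"
  shows "y \<in> generate G {a}"
proof -
  obtain n where n: "ord a = p ^ n" using ord_prime_power[OF a(1)] by blast
  have "n \<noteq> 0" using n a ord_eq_1 by (cases n) auto
  then obtain n' where n': "ord a = p ^ n' * p" using n by (cases n) (auto simp: mult.commute)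
  have p0: "p > 0" using prime by (simp add: prime_gt_0_nat)
  define b where "b = a [^] (p ^ n')"
  have b: "b \<in> carrier G" using a by (simp add: b_def)
  have "ord b = p" unfolding b_def
    using ord_pow[OF a(1), of "p ^ n'"] p0 n' by simp
  then have "b [^] p = \<one>" using b pow_ord_eq_1 by metis
  then have "b \<in> generate G {z}" using uniq b by blast
  then have sub: "generate G {b} \<subseteq> generate G {z}"
    using generate_subgroup_incl[OF _ subgroup_generate_singleton[OF z(1)]] by blast
  have "card (generate G {b}) = card (generate G {z})"
    using generate_pow_card b z \<open>ord b = p\<close> by simp
  moreover have "finite (generate G {z})"
    using finite_carrier generate_incl[of "{z}"] z by (meson empty_subsetI finite_subset insert_subset)
  ultimately have "generate G {b} = generate G {z}"
    using sub card_subset_eq by blast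
  then have "y \<in> generate G {b}" using uniq y by blast
  moreover have "b \<in> generate G {a}"
    using a by (auto simp: mem_generate_singleton b_def simp flip: int_pow_int)
  then have "generate G {b} \<subseteq> generate G {a}"
    using generate_subgroup_incl[OF _ subgroup_generate_singleton[OF a(1)]] by blast
  ultimately show ?thesis by blast
qed

text \<open>Let a generate a normal cyclic subgroup A of greatest order, with centralizer C. If C
  were larger, some y in C outside A would be fixed modulo A by conjugation, and a power x of y
  would lie outside A with x^p = a^m. If p divides m, then x times a power of a is p-torsion outside
  A. Otherwise x^p generates A, and x generates a larger normal cyclic subgroup.\<close>

lemma self_centralizing_cyclic:
  obtains a where "a \<in> carrier G" "a \<noteq> \<one>"
    "\<And>g. g \<in> carrier G \<Longrightarrow> g \<otimes> a \<otimes> inv g \<in> generate G {a}"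
    "\<And>x. x \<in> carrier G \<Longrightarrow> x \<otimes> a = a \<otimes> x \<Longrightarrow> x \<in> generate G {a}"
proof -
  \<comment> \<open>Normality of a cyclic subgroup needs to be tested only on its generator.
    \<open>z\<close> is a first candidate, so one of greatest order exists.\<close>
  define cyc where "cyc a \<longleftrightarrow> a \<in> carrier G \<and> a \<noteq> \<one> \<and>
    (\<forall>g\<in>carrier G. g \<otimes> a \<otimes> inv g \<in> generate G {a})" for a
  have "cyc z"
    unfolding cyc_def
  proof (intro conjI ballI)
    show "z \<in> carrier G" by (rule z)
    show "z \<noteq> \<one>" using z(2) prime by auto
    fix g assume g: "g \<in> carrier G"
    have "(g \<otimes> z \<otimes> inv g) [^] int p = g \<otimes> z [^] int p \<otimes> inv g"
      using conj_int_pow[OF g z(1)] by simp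
    also have "z [^] int p = \<one>" using z pow_ord_eq_1[OF z(1)] by (simp add: int_pow_int)
    finally show "g \<otimes> z \<otimes> inv g \<in> generate G {z}"
      using g z by (intro uniq) (auto simp: int_pow_int)
  qed
  moreover have "\<forall>y. cyc y \<longrightarrow> ord y < Suc (order G)"
    using ord_le_group_order[OF finite_carrier] by (auto simp: cyc_def less_Suc_eq_le)
  ultimately obtain a where a: "cyc a" and max: "\<And>b. cyc b \<Longrightarrow> ord b \<le> ord a"
    using ex_has_greatest_nat[of cyc z ord "Suc (order G)"] by blast
  have aG: "a \<in> carrier G" and a1: "a \<noteq> \<one>"
    and anorm: "\<And>g. g \<in> carrier G \<Longrightarrow> g \<otimes> a \<otimes> inv g \<in> generate G {a}"
    using a by (auto simp: cyc_def)
  define A where "A = generate G {a}"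
  define C where "C = {x \<in> carrier G. x \<otimes> a = a \<otimes> x}"
  note memA = mem_generate_singleton[OF aG, folded A_def]
  have comm: "x \<otimes> a [^] i = a [^] i \<otimes> x" if "x \<in> C" for x and i :: int
  proof -
    have "x \<otimes> a \<otimes> inv x = a" using that aG by (auto simp: C_def m_assoc)
    then have "x \<otimes> a [^] i \<otimes> inv x = a [^] i"
      using conj_int_pow[of x a i] that aG by (auto simp: C_def)
    then show ?thesis using that aG by (auto simp: C_def inv_solve_right')
  qed
  have subA: "subgroup A G" unfolding A_def by (rule subgroup_generate_singleton[OF aG])
  have normA: "A \<lhd> G"
    unfolding normal_inv_iff
  proof (intro conjI ballI subA)
    fix g h assume g: "g \<in> carrier G" and "h \<in> A"
    then obtain i :: int where "h = a [^] i" using memA by blast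
    then have "g \<otimes> h \<otimes> inv g = (g \<otimes> a \<otimes> inv g) [^] i" using conj_int_pow g aG by simp
    then show "g \<otimes> h \<otimes> inv g \<in> A"
      using anorm[OF g] subgroup_int_pow_closed[OF subA] by (simp add: A_def)
  qed
  have AC: "A \<subseteq> C"
  proof
    fix h assume "h \<in> A"
    then obtain i :: int where "h = a [^] i" using memA by blast
    moreover have "a [^] i \<otimes> a [^] (1::int) = a [^] (1::int) \<otimes> a [^] i"
      by (metis add.commute aG int_pow_mult)
    ultimately show "h \<in> C" using aG by (simp add: C_def)
  qed
  have subC: "subgroup C G"
  proof (rule subgroupI)
    show "inv x \<in> C" if "x \<in> C" for x
    proof -
      have x: "x \<in> carrier G" "a \<otimes> x = x \<otimes> a" using that by (auto simp: C_def)
      have "inv x \<otimes> a = inv x \<otimes> (a \<otimes> x) \<otimes> inv x"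
        using x(1) aG by (simp add: m_assoc)
      also have "\<dots> = a \<otimes> inv x"
        unfolding x(2) using x(1) aG by (simp flip: m_assoc)
      finally show ?thesis using x(1) by (simp add: C_def)
    qed
    show "x \<otimes> y \<in> C" if "x \<in> C" "y \<in> C" for x y
      using that aG unfolding C_def by simp (metis m_assoc)
  qed (use aG in \<open>auto simp: C_def intro!: exI[of _ \<one>]\<close>)
  have normC: "C \<lhd> G"
    unfolding normal_inv_iff
  proof (intro conjI ballI subC)
    fix g x assume g: "g \<in> carrier G" and x: "x \<in> C"
    have xG: "x \<in> carrier G" using x by (simp add: C_def)
    have ig: "inv g \<in> carrier G" using g by simp
    obtain i :: int where i: "inv g \<otimes> a \<otimes> inv (inv g) = a [^] i"
      using anorm[OF ig] memA A_def by blast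
    then have ai: "a = g \<otimes> a [^] i \<otimes> inv g"
      using g aG by (metis (no_types, lifting) conjugation_is_surj inv_inv)
    have "g \<otimes> x \<otimes> inv g \<otimes> (g \<otimes> a [^] i \<otimes> inv g) = g \<otimes> (x \<otimes> a [^] i) \<otimes> inv g"
      using g xG aG by (simp add: m_assoc inv_cancel)
    also have "\<dots> = g \<otimes> a [^] i \<otimes> inv g \<otimes> (g \<otimes> x \<otimes> inv g)"
      unfolding comm[OF x] using g xG aG by (simp add: m_assoc inv_cancel)
    finally show "g \<otimes> x \<otimes> inv g \<in> C"
      using ai g xG by (simp add: C_def)
  qed
  have "A = C"
  proof (rule ccontr)
    assume "A \<noteq> C"
    then obtain y where y: "y \<in> C - A" and yconj: "\<And>g. g \<in> carrier G \<Longrightarrow> g \<otimes> y \<otimes> inv g \<in> A #> y"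
      using central_modulo_normal[OF prime order normA normC] AC by blast
    have yG: "y \<in> carrier G" using y by (simp add: C_def)
    obtain j where j: "y [^] (p ^ j) \<notin> A" "y [^] (p ^ Suc j) \<in> A"
      using pow_eventually_in_subgroup[OF order subA yG] y by blast
    define x where "x = y [^] (p ^ j)"
    have xG: "x \<in> carrier G" using yG by (simp add: x_def)
    have xA: "x \<notin> A" using j by (simp add: x_def)
    have xp: "x [^] p \<in> A" using j yG by (simp add: x_def nat_pow_pow mult.commute)
    have xC: "x \<in> C" using y subC unfolding x_def int_pow_int[symmetric]
      by (intro subgroup_int_pow_closed) auto
    \<comment> \<open>Since y commutes with a, powers of \<open>a [^] i \<otimes> y\<close> split,
      and the power x of y is again changed by conjugation only by a power of a.\<close>
    have xconj: "\<exists>i::int. g \<otimes> x \<otimes> inv g = a [^] i \<otimes> x" if g: "g \<in> carrier G" for g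
    proof -
      obtain i :: int where i: "g \<otimes> y \<otimes> inv g = a [^] i \<otimes> y"
        using yconj[OF g] memA by (auto simp: r_coset_def)
      have "g \<otimes> x \<otimes> inv g = (g \<otimes> y \<otimes> inv g) [^] (p ^ j)"
        using conj_int_pow[OF g yG, of "int (p ^ j)"] by (simp only: x_def int_pow_int)
      also have "\<dots> = (a [^] i) [^] (p ^ j) \<otimes> x"
        unfolding i x_def using comm[of y i] y aG yG by (intro pow_mult_distrib) auto
      also have "(a [^] i) [^] (p ^ j) = a [^] (i * int (p ^ j))"
        using aG by (simp only: int_pow_pow flip: int_pow_int)
      finally show ?thesis by blast
    qed
    obtain m :: int where m: "x [^] p = a [^] m" using xp memA by blast
    show False
    proof (cases "int p dvd m")
      case True
      then obtain q where q: "m = int p * q" by blast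
      have "(a [^] (- q) \<otimes> x) [^] p = (a [^] (- q)) [^] p \<otimes> x [^] p"
        using comm[OF xC, of "- q"] aG xG by (intro pow_mult_distrib) auto
      also have "(a [^] (- q)) [^] p = a [^] (- m)"
        using aG by (simp add: q int_pow_pow mult.commute flip: int_pow_int)
      also have "a [^] (- m) \<otimes> x [^] p = \<one>"
        unfolding m using aG by (simp add: int_pow_neg)
      finally have "a [^] (- q) \<otimes> x \<in> A"
        unfolding A_def using aG a1 xG by (intro prime_torsion_in_generate) auto
      moreover have "a [^] q \<in> A" using memA by blast
      ultimately have "a [^] q \<otimes> (a [^] (- q) \<otimes> x) \<in> A"
        using subA by (simp add: subgroup.m_closed)
      also have "a [^] q \<otimes> (a [^] (- q) \<otimes> x) = x"
        using aG xG by (simp add: int_pow_neg flip: m_assoc)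
      finally show False using xA by simp
    next
      case False
      obtain n where n: "ord a = p ^ n" using ord_prime_power[OF aG] by blast
      have "coprime (int p) m"
        using False prime by (simp add: prime_imp_coprime)
      then have "coprime m (int (ord a))" by (simp add: n coprime_commute)
      then have "a \<in> generate G {x [^] p}" using mem_generate_coprime_pow[OF aG] m by simp
      moreover have "x [^] p \<in> generate G {x}"
        using xG by (auto simp: mem_generate_singleton simp flip: int_pow_int)
      then have "generate G {x [^] p} \<subseteq> generate G {x}"
        using generate_subgroup_incl[OF _ subgroup_generate_singleton[OF xG]] by blast
      ultimately have ax: "a \<in> generate G {x}" by blast
      note subX = subgroup_generate_singleton[OF xG]
      have xx: "x \<in> generate G {x}" by (simp add: generate.incl)
      \<comment> \<open>The conjugates of x have the form \<open>a [^] i \<otimes> x\<close>, and a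
        is itself a power of x.\<close>
      have "cyc x"
        unfolding cyc_def
      proof (intro conjI ballI)
        show "x \<noteq> \<one>" using xA subgroup.one_closed[OF subA] by auto
        fix g assume "g \<in> carrier G"
        then obtain i :: int where "g \<otimes> x \<otimes> inv g = a [^] i \<otimes> x" using xconj by blast
        then show "g \<otimes> x \<otimes> inv g \<in> generate G {x}"
          using subgroup.m_closed[OF subX subgroup_int_pow_closed[OF subX ax] xx] by simp
      qed (rule xG)
      then have "ord x \<le> ord a" by (rule max)
      then have le: "card (generate G {x}) \<le> card A"
        using generate_pow_card aG xG by (simp add: A_def)
      have "A \<subseteq> generate G {x}"
        unfolding A_def using generate_subgroup_incl[OF _ subX] ax by blast
      then have "A \<subset> generate G {x}" using xx xA by blast
      moreover have "finite (generate G {x})"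
        using subgroup.subset[OF subX] finite_carrier finite_subset by blast
      ultimately have "card A < card (generate G {x})" by (rule psubset_card_mono[rotated])
      then show False using le by simp
    qed
  qed
  then have "x \<in> generate G {a}" if "x \<in> carrier G" "x \<otimes> a = a \<otimes> x" for x
    using that by (auto simp: A_def C_def)
  then show ?thesis using that[OF aG a1 anorm] by blast
qed

text \<open>Write \<open>k\<close> for the exponent by which x acts on a, and x^p = a^m. The
  hypotheses of \<open>unsolvable_imp_inversion\<close> then say: x^p, a power of a, commutes with a
  (\<open>kp\<close>); x commutes with x^p (\<open>mk\<close>); x does not centralize a
  (\<open>k1\<close>); x^p does not generate A, as otherwise a would be a power of x
  (\<open>pm\<close>); no \<open>a [^] i \<otimes> x\<close> is p-torsion
  (\<open>unsolv\<close>).\<close>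

lemma pth_power_inside_imp_inversion:
  assumes a: "a \<in> carrier G" "a \<noteq> \<one>" and ord_a: "ord a = p ^ n"
    and norm: "\<And>g. g \<in> carrier G \<Longrightarrow> g \<otimes> a \<otimes> inv g \<in> generate G {a}"
    and self: "\<And>x. x \<in> carrier G \<Longrightarrow> x \<otimes> a = a \<otimes> x \<Longrightarrow> x \<in> generate G {a}"
    and x: "x \<in> carrier G" "x \<notin> generate G {a}" "x [^] p \<in> generate G {a}"
  shows "p = 2 \<and> n \<ge> 2 \<and> x \<otimes> a \<otimes> inv x = inv a \<and> x [^] p = a [^] (2 ^ (n - 1) :: nat)"
proof -
  define A where "A = generate G {a}"
  note memA = mem_generate_singleton[OF a(1), folded A_def]
  have subA: "subgroup A G" unfolding A_def by (rule subgroup_generate_singleton[OF a(1)])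
  obtain k :: int where k: "x \<otimes> a \<otimes> inv x = a [^] k" using norm[OF x(1)] a(1) mem_generate_singleton by blast
  obtain m :: int where m: "x [^] p = a [^] m" using x(3) a(1) mem_generate_singleton by blast
  have p0: "p > 0" using prime by (simp add: prime_gt_0_nat)
  have "n > 0" using ord_a a ord_eq_1 by (cases n) auto
  have eq_iff: "a [^] i = a [^] j \<longleftrightarrow> int (p ^ n) dvd i - j" for i j :: int
    using int_pow_eq[OF a(1), of j i] ord_a by auto
  note conjs = pow_commute_int_pow[OF a(1) x(1) k]
  have conj: "x \<otimes> a [^] i = a [^] (k * i) \<otimes> x" for i :: int
    using conjs[of 1] a x(1) by simp
  have "a [^] m \<otimes> a [^] (1::int) = a [^] (k ^ p * 1) \<otimes> a [^] m"
    using conjs[of p 1] unfolding m by simp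
  then have "int (p ^ n) dvd m + 1 - (k ^ p * 1 + m)"
    unfolding int_pow_mult[OF a(1), symmetric] eq_iff .
  then have kp: "int (p ^ n) dvd k ^ p - 1"
    by (simp add: dvd_diff_commute)
  have "x \<otimes> x [^] p = x [^] p \<otimes> x"
    using x(1) by (metis nat_pow_Suc nat_pow_Suc2)
  then have "a [^] (k * m) \<otimes> x = a [^] m \<otimes> x"
    unfolding m conj .
  then have "a [^] (k * m) = a [^] m" using a x(1) by simp
  then have mk: "int (p ^ n) dvd m * (k - 1)"
    unfolding eq_iff by (simp add: algebra_simps)
  have not_comm: "x \<otimes> a \<noteq> a \<otimes> x" using self x by blast
  have k1: "\<not> int (p ^ n) dvd k - 1"
    unfolding eq_iff[symmetric] using not_comm conj[of 1] a by auto
  have pm: "int p dvd m"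
  proof (rule ccontr)
    assume "\<not> int p dvd m"
    then have "coprime (int p) m"
      using prime by (simp add: prime_imp_coprime)
    then have "coprime m (int (ord a))" by (simp add: ord_a coprime_commute)
    then have "a \<in> generate G {x [^] p}" using mem_generate_coprime_pow[OF a(1)] m by simp
    moreover have "x [^] p \<in> generate G {x}"
      using x(1) by (auto simp: mem_generate_singleton simp flip: int_pow_int)
    then have "generate G {x [^] p} \<subseteq> generate G {x}"
      using generate_subgroup_incl[OF _ subgroup_generate_singleton[OF x(1)]] by blast
    ultimately obtain i :: int where "a = x [^] i" using x(1) mem_generate_singleton by blast
    moreover have "x [^] (1::int) \<otimes> x [^] i = x [^] i \<otimes> x [^] (1::int)"
      by (metis add.commute x(1) int_pow_mult)
    ultimately show False using not_comm x(1) by simp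
  qed
  have unsolv: "\<not> int (p ^ n) dvd i * (\<Sum>j<p. k ^ j) + m" for i
  proof
    assume "int (p ^ n) dvd i * (\<Sum>j<p. k ^ j) + m"
    then have "a [^] (i * (\<Sum>j<p. k ^ j) + m) = a [^] (0::int)"
      unfolding eq_iff by simp
    then have "(a [^] i \<otimes> x) [^] p = \<one>"
      unfolding pow_semidirect[OF a(1) x(1) k] m using a by (simp add: int_pow_mult)
    then have "a [^] i \<otimes> x \<in> A"
      unfolding A_def using a x by (intro prime_torsion_in_generate) auto
    moreover have "a [^] (- i) \<in> A" using memA by blast
    ultimately have "a [^] (- i) \<otimes> (a [^] i \<otimes> x) \<in> A"
      using subA by (simp add: subgroup.m_closed)
    then show False using x a by (simp add: A_def int_pow_neg inv_cancel)
  qed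
  have res: "p = 2 \<and> n \<ge> 2 \<and> 2 ^ n dvd k + 1 \<and> 2 ^ n dvd m - 2 ^ (n - 1)"
    by (rule unsolvable_imp_inversion[OF prime \<open>n > 0\<close> kp mk pm k1 unsolv])
  then have "a [^] k = a [^] (- 1 :: int)" "a [^] m = a [^] (int (2 ^ (n - 1)))"
    unfolding eq_iff by auto
  then show ?thesis
    using res a k m by (simp add: int_pow_neg int_pow_int del: of_nat_power)
qed

text \<open>Every element outside A, and not just some power of it, inverts a. Two inverting
  elements differ by one that centralizes a, hence by an element of A, so A has index at most
  two.\<close>

lemma cyclic_or_quaternion_relations:
  obtains "cyclic_group G"
  | a b n where "p = 2" "n \<ge> 2" "a \<in> carrier G" "b \<in> carrier G"
      "a [^] (2 ^ n :: nat) = \<one>" "b [^] (2::nat) = a [^] (2 ^ (n - 1) :: nat)"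
      "inv b \<otimes> a \<otimes> b = inv a" "order G = 2 ^ Suc n"
      "\<And>g. g \<in> carrier G \<Longrightarrow> \<exists>i::int. g = a [^] i \<or> g = a [^] i \<otimes> b"
proof -
  note thesis_cyclic = that(1) and thesis_quat = that(2)
  obtain a where a: "a \<in> carrier G" "a \<noteq> \<one>"
    and norm: "\<And>g. g \<in> carrier G \<Longrightarrow> g \<otimes> a \<otimes> inv g \<in> generate G {a}"
    and self: "\<And>x. x \<in> carrier G \<Longrightarrow> x \<otimes> a = a \<otimes> x \<Longrightarrow> x \<in> generate G {a}"
    using self_centralizing_cyclic by blast
  define A where "A = generate G {a}"
  note memA = mem_generate_singleton[OF a(1), folded A_def]
  have subA: "subgroup A G" unfolding A_def by (rule subgroup_generate_singleton[OF a(1)])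
  obtain n where n: "ord a = p ^ n" using ord_prime_power[OF a(1)] by blast
  note key = pth_power_inside_imp_inversion[OF a n norm self, folded A_def]
  have outside: "p = 2 \<and> n \<ge> 2 \<and> y \<otimes> a \<otimes> inv y = inv a \<and> y [^] p = a [^] (2 ^ (n - 1) :: nat)"
    if y: "y \<in> carrier G" "y \<notin> A" for y
  proof -
    obtain j where j: "y [^] (p ^ j) \<notin> A" "y [^] (p ^ Suc j) \<in> A"
      using pow_eventually_in_subgroup[OF order subA y] by blast
    have "(y [^] (p ^ j)) [^] p \<in> A" using j y by (simp add: nat_pow_pow mult.commute)
    then have x: "p = 2 \<and> n \<ge> 2 \<and> y [^] (p ^ j) \<otimes> a \<otimes> inv (y [^] (p ^ j)) = inv a
        \<and> (y [^] (p ^ j)) [^] p = a [^] (2 ^ (n - 1) :: nat)"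
      using j y by (intro key) auto
    \<comment> \<open>If a proper power were needed, it would be the square of an element w acting
      on a by some exponent k. Then k^2 = -1 modulo 2^n with n at least 2, but -1 is not a square
      modulo 4.\<close>
    have "j = 0"
    proof (rule ccontr)
      assume "j \<noteq> 0"
      then obtain i where i: "j = Suc i" by (cases j) auto
      define w where "w = y [^] (2 ^ i :: nat)"
      have w: "w \<in> carrier G" using y by (simp add: w_def)
      have ww: "y [^] (p ^ j) = w \<otimes> w"
        using x y by (simp add: i w_def nat_pow_mult mult_2)
      obtain k :: int where k: "w \<otimes> a \<otimes> inv w = a [^] k"
        using norm[OF w] memA A_def by blast
      have "w \<otimes> w \<otimes> a \<otimes> inv (w \<otimes> w) = w \<otimes> (w \<otimes> a \<otimes> inv w) \<otimes> inv w"
        using w a by (simp add: m_assoc inv_mult_group)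
      also have "\<dots> = a [^] (k * k)"
        using conj_int_pow[OF w a(1), of k] a by (simp add: k int_pow_pow)
      finally have "a [^] (k * k) = a [^] (- 1 :: int)"
        using x a unfolding ww by (simp add: int_pow_neg)
      then have "int (2 ^ n) dvd - 1 - k * k"
        using int_pow_eq[OF a(1), of "k * k" "- 1"] n x by simp
      moreover have "(4::int) dvd int (2 ^ n)"
        using x le_imp_power_dvd[of 2 n "2::int"] by simp
      ultimately have "4 dvd k * k + 1"
        by (metis dvd_minus_iff dvd_trans minus_add_distrib uminus_add_conv_diff add.commute
            minus_diff_eq diff_minus_eq_add)
      then have "(k * k + 1) mod 4 = 0" by simp
      moreover have "(k * k + 1) mod 4 = ((k mod 4) * (k mod 4) + 1) mod 4"
        by (metis mod_add_left_eq mod_mult_eq)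
      moreover have "k mod 4 = 0 \<or> k mod 4 = 1 \<or> k mod 4 = 2 \<or> k mod 4 = 3" by presburger
      ultimately show False by auto
    qed
    then have "y [^] (p ^ j) = y" using y by simp
    then show ?thesis using x by metis
  qed
  show thesis
  proof (cases "A = carrier G")
    case True
    then have "carrier G = range (\<lambda>i::int. a [^] i)" using memA by auto
    then show thesis using thesis_cyclic cyclic_group a(1) by blast
  next
    case False
    then obtain b where b: "b \<in> carrier G" "b \<notin> A" using subgroup.subset[OF subA] by blast
    note B = outside[OF b]
    have conj_inv: "inv y \<otimes> a \<otimes> y = inv a" if y: "y \<in> carrier G" "y \<notin> A" for y
    proof -
      have "y \<otimes> inv a \<otimes> inv y = a"
        using conj_int_pow[OF y(1) a(1), of "- 1"] outside[OF y] a by (simp add: int_pow_neg)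
      then have "inv y \<otimes> a \<otimes> y = inv y \<otimes> (y \<otimes> inv a \<otimes> inv y) \<otimes> y" by simp
      also have "\<dots> = inv a" using y a by (simp add: m_assoc inv_cancel)
      finally show ?thesis .
    qed
    \<comment> \<open>Both g and b invert a, so \<open>g \<otimes> inv b\<close> centralizes a and
      lies in A.\<close>
    have cosetA: "g \<otimes> inv b \<in> A" if g: "g \<in> carrier G" "g \<notin> A" for g
    proof -
      have "g \<otimes> inv b \<otimes> a \<otimes> inv (g \<otimes> inv b) = g \<otimes> (inv b \<otimes> a \<otimes> b) \<otimes> inv g"
        using g b a by (simp add: m_assoc inv_mult_group)
      also have "\<dots> = (g \<otimes> a \<otimes> inv g) [^] (- 1 :: int)"
        using conj_inv[OF b] conj_int_pow[OF g(1) a(1), of "- 1"] a by (simp add: int_pow_neg)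
      also have "\<dots> = a" using outside[OF g] a by (simp add: int_pow_neg)
      finally have "g \<otimes> inv b \<otimes> a = a \<otimes> (g \<otimes> inv b)"
        using g b a by (simp add: inv_solve_right')
      then show ?thesis unfolding A_def using g b by (intro self) auto
    qed
    have cover: "\<exists>i::int. g = a [^] i \<or> g = a [^] i \<otimes> b" if g: "g \<in> carrier G" for g
    proof (cases "g \<in> A")
      case True
      then show ?thesis using memA by blast
    next
      case False
      then obtain i :: int where "g \<otimes> inv b = a [^] i" using cosetA[OF g] memA by blast
      then have "g = a [^] i \<otimes> b" using g b a by (simp add: inv_solve_right')
      then show ?thesis by blast
    qed
    have "carrier G = A \<union> (\<lambda>h. h \<otimes> b) ` A"
    proof
      show "carrier G \<subseteq> A \<union> (\<lambda>h. h \<otimes> b) ` A" using cover memA by blast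
      show "A \<union> (\<lambda>h. h \<otimes> b) ` A \<subseteq> carrier G" using subgroup.subset[OF subA] b by auto
    qed
    moreover have "A \<inter> (\<lambda>h. h \<otimes> b) ` A = {}"
    proof -
      have "h \<otimes> b \<notin> A" if "h \<in> A" for h
      proof
        assume "h \<otimes> b \<in> A"
        then have "inv h \<otimes> (h \<otimes> b) \<in> A"
          using that subA by (simp add: subgroup.m_closed subgroup.m_inv_closed)
        then show False using b that subgroup.mem_carrier[OF subA] by (simp add: inv_cancel)
      qed
      then show ?thesis by blast
    qed
    moreover have "finite A" using subgroup.subset[OF subA] finite_carrier finite_subset by blast
    moreover have "inj_on (\<lambda>h. h \<otimes> b) A"
      using subgroup.mem_carrier[OF subA] b by (auto intro: inj_onI)
    ultimately have "order G = card A + card A"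
      unfolding order_def by (simp add: card_Un_disjoint card_image)
    also have "card A = 2 ^ n" using generate_pow_card[OF a(1)] n B by (simp add: A_def)
    finally have "order G = 2 ^ Suc n" by simp
    moreover have "a [^] (2 ^ n :: nat) = \<one>" using pow_ord_eq_1[OF a(1)] n B by simp
    ultimately show thesis
      using B b a conj_inv[OF b] cover by (intro thesis_quat[of n a b]) auto
  qed
qed

end

section \<open>Generalized quaternion groups\<close>

fun word_value :: "('a, 'b) monoid_scheme \<Rightarrow> ('x \<Rightarrow> 'a) \<Rightarrow> 'x word \<Rightarrow> 'a" where
  "word_value G f [] = \<one>\<^bsub>G\<^esub>"
| "word_value G f ((x, e) # u) = (if e then f x else inv\<^bsub>G\<^esub> (f x)) \<otimes>\<^bsub>G\<^esub> word_value G f u"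

context group
begin

lemma word_value_closed [simp]: "range f \<subseteq> carrier G \<Longrightarrow> word_value G f u \<in> carrier G"
  by (induction u) (auto simp: range_subsetD)

lemma word_value_append:
  "range f \<subseteq> carrier G \<Longrightarrow> word_value G f (u @ v) = word_value G f u \<otimes> word_value G f v"
  by (induction u) (auto simp: m_assoc range_subsetD)

lemma word_value_replicate:
  assumes "range f \<subseteq> carrier G"
  shows "word_value G f (replicate n (x, True)) = f x [^] n"
proof (induction n)
  case (Suc n)
  have "f x \<otimes> f x [^] n = f x [^] n \<otimes> f x"
    using assms nat_pow_Suc nat_pow_Suc2 by (metis range_subsetD)
  then show ?case using Suc by simp
qed simp

lemma word_value_cong:
  assumes "range f \<subseteq> carrier G" and "\<And>u v. (u, v) \<in> R \<Longrightarrow> word_value G f u = word_value G f v"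
    and "word_eq R u v"
  shows "word_value G f u = word_value G f v"
  using assms(3)
proof induction
  case (cancel x e)
  then show ?case using assms(1) by (auto simp: range_subsetD)
qed (use assms(1,2) in \<open>auto simp: word_value_append\<close>)

text \<open>The universal property of a presentation (von Dyck). \<open>F\<close> evaluates an
  arbitrary representative; \<open>word_value_cong\<close> makes the choice irrelevant.\<close>

lemma presented_group_hom:
  assumes f: "range f \<subseteq> carrier G" and R: "\<And>u v. (u, v) \<in> R \<Longrightarrow> word_value G f u = word_value G f v"
  obtains F where "F \<in> hom (presented_group R) G" "\<And>u. F (word_class R u) = word_value G f u"
proof
  define F where "F C = word_value G f (SOME u. u \<in> C)" for C
  show F: "F (word_class R u) = word_value G f u" for u
  proof -
    have "(SOME v. v \<in> word_class R u) \<in> word_class R u"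
      by (rule someI[of _ u]) (simp add: word_class_def word_eq.refl)
    then have "word_eq R u (SOME v. v \<in> word_class R u)" by (simp add: word_class_def)
    then show ?thesis
      unfolding F_def using word_value_cong[OF f R] by metis
  qed
  have carrier: "carrier (presented_group R) = range (word_class R)"
    by (simp add: presented_group_def)
  show "F \<in> hom (presented_group R) G"
    unfolding hom_def carrier using f
    by (auto simp: mult_word_class F word_value_append)
qed

text \<open>Left multiplication by a letter preserves the normal forms because b a^i = a^(-i) b, b^2
  = a^n and b^(-1) = a^(-n) b.\<close>

lemma quaternion_normal_form_step:
  assumes a: "a \<in> carrier G" and b: "b \<in> carrier G"
    and bb: "b [^] (2::nat) = a [^] (n::nat)" and act: "inv b \<otimes> a \<otimes> b = inv a"
    and s: "\<exists>i::int. s = a [^] i \<or> s = a [^] i \<otimes> b" and l: "l \<in> {a, inv a, b, inv b}"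
  shows "\<exists>i::int. l \<otimes> s = a [^] i \<or> l \<otimes> s = a [^] i \<otimes> b"
proof -
  define S where "S = {s. \<exists>i::int. s = a [^] i \<or> s = a [^] i \<otimes> b}"
  have S: "s \<in> carrier G" if "s \<in> S" for s using that a b by (auto simp: S_def)
  have A: "a [^] j \<otimes> s \<in> S" if "s \<in> S" for j :: int and s
    using that a b by (auto simp: S_def simp flip: m_assoc int_pow_mult)
  have bb': "b \<otimes> b = a [^] int n" using bb b by (simp add: numeral_2_eq_2 int_pow_int)
  have "b \<otimes> inv a \<otimes> inv b = a"
    unfolding act[symmetric] using a b by (simp add: m_assoc inv_cancel)
  then have "inv (b \<otimes> inv a \<otimes> inv b) = inv a" by simp
  then have bab: "b \<otimes> a \<otimes> inv b = inv a" using a b by (simp add: inv_mult_group m_assoc)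
  then have ba: "b \<otimes> a [^] i = a [^] (- i) \<otimes> b" for i :: int
    using conj_int_pow[OF b a, of i, unfolded bab] a b
    by (simp add: int_pow_inv int_pow_neg inv_solve_right' del: inv_mult_group)
  have B: "b \<otimes> s \<in> S" if s: "s \<in> S" for s
  proof -
    obtain i :: int where "s = a [^] i \<or> s = a [^] i \<otimes> b" using s S_def by blast
    moreover have "b \<otimes> (a [^] i \<otimes> b) = a [^] (- i + int n)"
    proof -
      have "b \<otimes> (a [^] i \<otimes> b) = b \<otimes> a [^] i \<otimes> b" using a b by (simp add: m_assoc)
      also have "\<dots> = a [^] (- i) \<otimes> (b \<otimes> b)" unfolding ba using a b by (simp add: m_assoc)
      finally show ?thesis using int_pow_mult[OF a, of "- i" "int n"] by (simp only: bb')
    qed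
    ultimately show ?thesis using ba by (auto simp: S_def)
  qed
  have "inv b = a [^] (- int n) \<otimes> b"
  proof -
    have "a [^] (- int n) \<otimes> b \<otimes> b = \<one>"
      using a b by (simp add: m_assoc bb' int_pow_neg)
    then show ?thesis using a b by (metis inv_equality m_closed int_pow_closed)
  qed
  then have "inv b \<otimes> s \<in> S" if "s \<in> S" for s
    using A[OF B[OF that]] S[OF that] a b by (simp add: m_assoc)
  moreover have "a \<otimes> s \<in> S" "inv a \<otimes> s \<in> S" if "s \<in> S" for s
    using A[OF that, of 1] A[OF that, of "- 1"] a by (simp_all add: int_pow_neg)
  ultimately have "l \<otimes> s \<in> S" using l s B unfolding S_def by blast
  then show ?thesis unfolding S_def by blast
qed

end

text \<open>Building a word letter by letter keeps it in the form a^i or a^i b, and i counts only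
  modulo 2n. A collapse of the presented group to a smaller one is not excluded here; that follows
  where it surjects onto a group of order 4n.\<close>

lemma card_generalized_quaternion_le:
  assumes "n > 0"
  shows "finite (carrier (generalized_quaternion n))" "card (carrier (generalized_quaternion n)) \<le> 4 * n"
proof -
  let ?R = "quat_relations n" and ?Q = "generalized_quaternion n"
  interpret Q: group ?Q
    by (simp add: generalized_quaternion_def group_presented_group)
  note mult = mult_word_class[of ?R, folded generalized_quaternion_def]
  have carrier: "carrier ?Q = range (word_class ?R)" and one: "\<one>\<^bsub>?Q\<^esub> = word_class ?R []"
    by (simp_all add: generalized_quaternion_def presented_group_def)
  have in_carrier: "word_class ?R u \<in> carrier ?Q" for u by (simp add: carrier)
  define a where "a = word_class ?R [(Gen_a, True)]"
  define b where "b = word_class ?R [(Gen_b, True)]"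
  have a: "a \<in> carrier ?Q" and b: "b \<in> carrier ?Q" by (simp_all add: a_def b_def in_carrier)
  have inv: "inv\<^bsub>?Q\<^esub> (word_class ?R [(x, True)]) = word_class ?R [(x, False)]" for x
  proof (rule Q.inv_equality)
    show "word_class ?R [(x, False)] \<otimes>\<^bsub>?Q\<^esub> word_class ?R [(x, True)] = \<one>\<^bsub>?Q\<^esub>"
      using word_eq.cancel[of ?R x False] by (simp add: mult one word_class_eq_iff)
  qed (simp_all add: in_carrier)
  have pow: "word_class ?R (replicate k (x, True)) = word_class ?R [(x, True)] [^]\<^bsub>?Q\<^esub> k" for x and k :: nat
  proof (induction k)
    case (Suc k)
    then show ?case
      by (simp add: mult Suc[symmetric] replicate_append_same)
  qed (simp add: one)
  have rel: "word_class ?R u = word_class ?R v" if "(u, v) \<in> ?R" for u v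
    using that by (simp add: word_class_eq_iff word_eq.relation)
  have bb: "b [^]\<^bsub>?Q\<^esub> (2::nat) = a [^]\<^bsub>?Q\<^esub> n"
    unfolding a_def b_def pow[symmetric] by (rule rel[symmetric]) (simp add: quat_relations_def)
  have a2n: "a [^]\<^bsub>?Q\<^esub> (2 * n) = \<one>\<^bsub>?Q\<^esub>"
    unfolding a_def one pow[symmetric] by (rule rel) (simp add: quat_relations_def)
  have act: "inv\<^bsub>?Q\<^esub> b \<otimes>\<^bsub>?Q\<^esub> a \<otimes>\<^bsub>?Q\<^esub> b = inv\<^bsub>?Q\<^esub> a"
  proof -
    have "word_class ?R [(Gen_b, False), (Gen_a, True), (Gen_b, True)] = word_class ?R [(Gen_a, False)]"
      by (rule rel) (simp add: quat_relations_def)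
    then show ?thesis by (simp add: a_def b_def inv mult)
  qed
  have nf: "\<exists>i::int. word_class ?R u = a [^]\<^bsub>?Q\<^esub> i \<or> word_class ?R u = a [^]\<^bsub>?Q\<^esub> i \<otimes>\<^bsub>?Q\<^esub> b" for u
  proof (induction u)
    case Nil
    show ?case by (rule exI[of _ 0]) (simp add: one)
  next
    case (Cons xe u)
    obtain x e where xe: "xe = (x, e)" by (cases xe)
    have "word_class ?R [(x, e)] \<in> {a, inv\<^bsub>?Q\<^esub> a, b, inv\<^bsub>?Q\<^esub> b}"
      by (cases x; cases e) (simp_all add: a_def b_def inv)
    from Q.quaternion_normal_form_step[OF a b bb act Cons this] show ?case
      by (simp add: mult xe)
  qed
  define h where "h = (\<lambda>(i :: int, j :: nat). a [^]\<^bsub>?Q\<^esub> i \<otimes>\<^bsub>?Q\<^esub> b [^]\<^bsub>?Q\<^esub> j)"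
  have red: "a [^]\<^bsub>?Q\<^esub> i = a [^]\<^bsub>?Q\<^esub> (i mod int (2 * n))" for i :: int
  proof -
    have "Q.ord a dvd 2 * n" using a2n Q.pow_eq_id[OF a] by blast
    then have "int (Q.ord a) dvd i mod int (2 * n) - i"
      by (metis dvd_trans int_dvd_int_iff minus_mod_eq_mult_div dvd_diff_commute dvd_triv_left)
    then show ?thesis using Q.int_pow_eq[OF a] by blast
  qed
  have sub: "carrier ?Q \<subseteq> h ` ({0..<int (2 * n)} \<times> {0, 1})"
  proof
    fix s assume "s \<in> carrier ?Q"
    then obtain u where "s = word_class ?R u" using carrier by auto
    then obtain i :: int where i: "s = a [^]\<^bsub>?Q\<^esub> i \<or> s = a [^]\<^bsub>?Q\<^esub> i \<otimes>\<^bsub>?Q\<^esub> b"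
      using nf[of u] by auto
    have "i mod int (2 * n) \<in> {0..<int (2 * n)}" using assms by simp
    moreover have "s = h (i mod int (2 * n), 0) \<or> s = h (i mod int (2 * n), 1)"
      using i[unfolded red[of i]] a b by (simp add: h_def)
    ultimately show "s \<in> h ` ({0..<int (2 * n)} \<times> {0, 1})" by blast
  qed
  then show "finite (carrier ?Q)" by (rule finite_subset) simp
  have "card (carrier ?Q) \<le> card ({0..<int (2 * n)} \<times> {0, 1 :: nat})"
    using sub by (rule surj_card_le[rotated]) simp
  then show "card (carrier ?Q) \<le> 4 * n" by (simp add: card_cartesian_product)
qed

text \<open>The relations give a homomorphism from the presented group, which is onto since its
  image contains a and b. Comparing orders makes it injective.\<close>

lemma (in group) iso_generalized_quaternionI:
  assumes n: "n > 0" and a: "a \<in> carrier G" and b: "b \<in> carrier G"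
    and "a [^] (2 * n) = \<one>" "b [^] (2::nat) = a [^] n" "inv b \<otimes> a \<otimes> b = inv a"
    and ord: "order G = 4 * n"
    and cover: "\<And>g. g \<in> carrier G \<Longrightarrow> \<exists>i::int. g = a [^] i \<or> g = a [^] i \<otimes> b"
  shows "G \<cong> generalized_quaternion n"
proof -
  let ?Q = "generalized_quaternion n" and ?R = "quat_relations n"
  define f where "f x = (case x of Gen_a \<Rightarrow> a | Gen_b \<Rightarrow> b)" for x
  have f: "range f \<subseteq> carrier G" using a b by (auto simp: f_def split: quat_gen.split)
  have "word_value G f u = word_value G f v" if "(u, v) \<in> ?R" for u v
    using that assms f
    by (auto simp: quat_relations_def word_value_replicate m_assoc)
      (auto simp: f_def m_assoc numeral_2_eq_2)
  then obtain F where F: "F \<in> hom (presented_group ?R) G"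
    and Fw: "\<And>u. F (word_class ?R u) = word_value G f u"
    using presented_group_hom[OF f] by blast
  interpret F: group_hom ?Q G F
    using F by (simp add: group_hom_def group_hom_axioms_def generalized_quaternion_def
        group_presented_group is_group)
  have img: "subgroup (F ` carrier ?Q) G" by (rule F.img_is_subgroup)
  have "word_class ?R u \<in> carrier ?Q" for u
    by (simp add: generalized_quaternion_def presented_group_def)
  then have "word_value G f u \<in> F ` carrier ?Q" for u
    unfolding Fw[symmetric] by blast
  from this[of "[(Gen_a, True)]"] this[of "[(Gen_b, True)]"]
  have "a \<in> F ` carrier ?Q" "b \<in> F ` carrier ?Q" using a b by (simp_all add: f_def)
  then have "a [^] i \<in> F ` carrier ?Q" "a [^] i \<otimes> b \<in> F ` carrier ?Q" for i :: int
    using subgroup_int_pow_closed[OF img] subgroup.m_closed[OF img] by blast+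
  then have "carrier G \<subseteq> F ` carrier ?Q" using cover by (metis subsetI)
  then have surj: "F ` carrier ?Q = carrier G" using F.hom_closed by blast
  note le = card_generalized_quaternion_le[OF n]
  have "card (F ` carrier ?Q) = card (carrier ?Q)"
    using le card_image_le[OF le(1), of F] ord surj by (simp add: order_def)
  then have "inj_on F (carrier ?Q)" using le(1) by (simp add: eq_card_imp_inj_on)
  then have "F \<in> iso ?Q G"
    using surj F.homh by (simp add: iso_def bij_betw_def)
  then have "?Q \<cong> G" by (auto simp: is_iso_def)
  then show ?thesis using group.iso_sym[OF F.G.is_group] by blast
qed

theorem (in unique_prime_subgroup) nice: "nice_group G"
proof (rule cyclic_or_quaternion_relations)
  assume "cyclic_group G"
  then show ?thesis
    using is_group finite_carrier prime order by (auto simp: nice_group_def)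
next
  fix a b n
  assume *: "p = 2" "n \<ge> 2" "a \<in> carrier G" "b \<in> carrier G" "a [^] (2 ^ n :: nat) = \<one>"
    "b [^] (2::nat) = a [^] (2 ^ (n - 1) :: nat)" "inv b \<otimes> a \<otimes> b = inv a" "order G = 2 ^ Suc n"
    "\<And>g. g \<in> carrier G \<Longrightarrow> \<exists>i::int. g = a [^] i \<or> g = a [^] i \<otimes> b"
  obtain m where m: "n = Suc (Suc m)" using *(2) by (metis add_2_eq_Suc le_Suc_ex)
  \<comment> \<open>The exponent 2^n of \<open>a\<close> is the 2n of the presentation, so the
    parameter is half of it; n at least 2 makes the parameter at least 2.\<close>
  have "G \<cong> generalized_quaternion (2 ^ (n - 1))"
    by (rule iso_generalized_quaternionI[of _ a b]) (use * in \<open>auto simp: m\<close>)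
  moreover have "2 ^ (n - 1) \<ge> (2::nat)" by (simp add: m)
  ultimately show ?thesis
    using is_group finite_carrier *(8) unfolding nice_group_def by blast
qed

section \<open>Subgroups with disjoint conjugates\<close>

context group
begin

lemma cauchy_element:
  assumes "finite (carrier G)" "prime p" "p dvd order G"
  obtains x where "x \<in> carrier G" "ord x = p"
proof -
  obtain m where "order G = p ^ 1 * m" using assms(3) by (auto elim: dvdE)
  \<comment> \<open>Sylow's theorem for the exponent one, rather than for the full power of p in the
    order.\<close>
  then obtain H where H: "subgroup H G" "card H = p"
    using sylow_thm[OF assms(2) is_group _ assms(1), of 1 m] by auto
  have "\<not> H \<subseteq> {\<one>}" using H(2) prime_gt_1_nat[OF assms(2)]
    by (metis card.empty card_1_singleton_iff less_one not_less_iff_gr_or_eq subset_singletonD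
        One_nat_def zero_less_one less_trans)
  then obtain x where x: "x \<in> H" "x \<noteq> \<one>" by blast
  have xG: "x \<in> carrier G" using x H by (auto intro: subgroup.mem_carrier)
  interpret H: group "G\<lparr>carrier := H\<rparr>" using H by (simp add: subgroup.subgroup_is_group is_group)
  have "x [^]\<^bsub>G\<lparr>carrier := H\<rparr>\<^esub> p = \<one>"
    using H.pow_order_eq_1[of x] x H by (simp add: order_def)
  then have "x [^] p = \<one>" by (simp flip: nat_pow_consistent)
  then have "ord x dvd p" using pow_eq_id[OF xG] by blast
  moreover have "ord x \<noteq> 1" using ord_eq_1[OF xG] x by simp
  ultimately have "ord x = p" using assms(2) by (metis prime_nat_iff)
  then show ?thesis using that xG by blast
qed

lemma generate_ne_trivial: "a \<noteq> \<one> \<Longrightarrow> generate G {a} \<noteq> {\<one>}"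
  using generate.incl[of a "{a}" G] by blast

lemma pow_ord_mem_generate:
  assumes "a \<in> carrier G" "h \<in> generate G {a}"
  shows "h [^] ord a = \<one>"
proof -
  obtain i :: int where "h = a [^] i" using assms mem_generate_singleton by blast
  then have "h [^] int (ord a) = (a [^] int (ord a)) [^] i"
    using assms(1) by (simp add: int_pow_pow mult.commute)
  also have "a [^] int (ord a) = \<one>" using assms(1) pow_ord_eq_1 by (simp add: int_pow_int)
  finally show ?thesis by (simp add: int_pow_int)
qed

text \<open>With two primes, a conjugate of h lying in the other subgroup has order dividing both.
  In a p-group the first subgroup is central, so conjugation does nothing, and a nontrivial common
  element would generate both subgroups of order p.\<close>

lemma not_nice_imp_conjugate_disjoint_subgroups:
  assumes fin: "finite (carrier G)" and nontriv: "carrier G \<noteq> {\<one>}" and "\<not> nice_group G"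
  obtains H1 H2 where "subgroup H1 G" "H1 \<noteq> {\<one>}" "subgroup H2 G" "H2 \<noteq> {\<one>}"
    "\<And>g h. g \<in> carrier G \<Longrightarrow> h \<in> H1 \<Longrightarrow> g \<otimes> h \<otimes> inv g \<in> H2 \<Longrightarrow> h = \<one>"
proof -
  note result = that
  have pos: "order G > 0" using fin order_gt_0_iff_finite by blast
  have "order G \<noteq> 1"
    using nontriv one_closed by (metis card_1_singletonE order_def singletonD)
  then obtain p where p: "prime p" "p dvd order G" using prime_factor_nat by blast
  obtain z' where z': "z' \<in> carrier G" "ord z' = p" using cauchy_element[OF fin p] by blast
  show thesis
  proof (cases "\<exists>q. prime q \<and> q dvd order G \<and> q \<noteq> p")
    case True
    then obtain q where q: "prime q" "q dvd order G" "q \<noteq> p" by blast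
    obtain y where y: "y \<in> carrier G" "ord y = q" using cauchy_element[OF fin q(1,2)] by blast
    show thesis
    proof (rule result)
      show "generate G {z'} \<noteq> {\<one>}" "generate G {y} \<noteq> {\<one>}"
        using z' y p(1) q(1) by (auto intro!: generate_ne_trivial simp: prime_nat_iff)
      fix g h assume g: "g \<in> carrier G" and h: "h \<in> generate G {z'}" "g \<otimes> h \<otimes> inv g \<in> generate G {y}"
      have hG: "h \<in> carrier G" using h(1) z'(1) mem_generate_singleton by auto
      have "(g \<otimes> h \<otimes> inv g) [^] int p = g \<otimes> h [^] int p \<otimes> inv g"
        using conj_int_pow[OF g hG] by simp
      also have "h [^] int p = \<one>"
        using pow_ord_mem_generate[OF z'(1) h(1)] z' by (simp add: int_pow_int)
      finally have "(g \<otimes> h \<otimes> inv g) [^] p = \<one>" using g by (simp add: int_pow_int)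
      moreover have "(g \<otimes> h \<otimes> inv g) [^] q = \<one>"
        using pow_ord_mem_generate[OF y(1) h(2)] y by simp
      ultimately have "ord (g \<otimes> h \<otimes> inv g) dvd p" "ord (g \<otimes> h \<otimes> inv g) dvd q"
        using g hG by (simp_all add: pow_eq_id)
      then have "ord (g \<otimes> h \<otimes> inv g) = 1"
        using p(1) q(1,3) by (metis prime_nat_iff)
      then have "g \<otimes> h \<otimes> inv g = \<one>" using g hG ord_eq_1 by simp
      then have "inv g \<otimes> (g \<otimes> h \<otimes> inv g) \<otimes> g = \<one>" using g by simp
      then show "h = \<one>" using g hG by (simp add: m_assoc inv_cancel)
    qed (use y z' in \<open>auto intro: subgroup_generate_singleton\<close>)
  next
    case False
    obtain N m where m: "order G = p ^ N * m" "\<not> p dvd m"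
      using pos p(1) by (metis multiplicity_decompose' not_prime_unit nat_neq_iff mult.commute)
    have "m = 1"
    proof (rule ccontr)
      assume "m \<noteq> 1"
      then obtain q where "prime q" "q dvd m" using prime_factor_nat by blast
      then show False using False m by (metis dvd_mult)
    qed
    then have N: "order G = p ^ N" using m by simp
    \<comment> \<open>Being central modulo the trivial subgroup is being central, so this produces a
      nontrivial element of the center.\<close>
    have "{\<one>} \<lhd> G" "carrier G \<lhd> G" "{\<one>} \<subset> carrier G"
      using nontriv one_is_normal normal_inv_iff[of "carrier G"] subgroup_self by auto
    then obtain x where x: "x \<in> carrier G - {\<one>}"
      "\<And>g. g \<in> carrier G \<Longrightarrow> g \<otimes> x \<otimes> inv g \<in> {\<one>} #> x"
      using central_modulo_normal[OF p(1) N] by metis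
    have xG: "x \<in> carrier G" using x by blast
    have central: "g \<otimes> x \<otimes> inv g = x" if "g \<in> carrier G" for g
      using x(2)[OF that] xG by (simp add: r_coset_def)
    have "ord x dvd p ^ N" using ord_dvd_group_order[OF xG] N by simp
    then obtain n where n: "ord x = p ^ n" using p(1) divides_primepow_nat by blast
    have "n \<noteq> 0" using n x ord_eq_1[OF xG] by (cases n) auto
    then obtain n' where n': "ord x = p ^ n' * p" using n by (cases n) (auto simp: mult.commute)
    define z where "z = x [^] (p ^ n')"
    have z: "z \<in> carrier G" "ord z = p"
      using xG ord_pow[OF xG, of "p ^ n'"] n' p(1) by (auto simp: z_def)
    have zcentral: "g \<otimes> h \<otimes> inv g = h" if g: "g \<in> carrier G" and h: "h \<in> generate G {z}" for g h
    proof -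
      obtain i :: int where "h = (x [^] int (p ^ n')) [^] i"
        using h z mem_generate_singleton by (auto simp: z_def int_pow_int simp del: of_nat_power)
      then have h: "h = x [^] (int (p ^ n') * i)" using xG by (simp only: int_pow_pow)
      show ?thesis unfolding h conj_int_pow[OF g xG] central[OF g] ..
    qed
    \<comment> \<open>All other assumptions of the locale hold, so it is \<open>uniq\<close> that
      fails; this supplies the second subgroup of order p.\<close>
    have "\<not> unique_prime_subgroup G p N z"
      using assms(3) by (auto dest: unique_prime_subgroup.nice)
    then obtain y where y: "y \<in> carrier G" "y [^] p = \<one>" "y \<notin> generate G {z}"
      using N p(1) z
      by (auto simp: unique_prime_subgroup_def unique_prime_subgroup_axioms_def is_group)
    have "y \<noteq> \<one>" using y(3) generate.one by blast
    have ordp: "ord w = p" if "w \<in> carrier G" "w [^] p = \<one>" "w \<noteq> \<one>" for w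
      using that p(1) pow_eq_id[of w p] ord_eq_1[of w] by (metis prime_nat_iff)
    show thesis
    proof (rule result)
      show "generate G {z} \<noteq> {\<one>}" "generate G {y} \<noteq> {\<one>}"
        using z p(1) \<open>y \<noteq> \<one>\<close> by (auto intro!: generate_ne_trivial simp: prime_nat_iff)
      fix g h assume g: "g \<in> carrier G" and hz: "h \<in> generate G {z}" and "g \<otimes> h \<otimes> inv g \<in> generate G {y}"
      then have hy: "h \<in> generate G {y}" using zcentral by simp
      have hG: "h \<in> carrier G" using hz z(1) mem_generate_singleton by auto
      show "h = \<one>"
      proof (rule ccontr)
        assume "h \<noteq> \<one>"
        then have "ord h = p" using ordp[OF hG] pow_ord_mem_generate[OF z(1) hz] z by simp
        moreover have "ord y = p" using ordp y(1,2) \<open>y \<noteq> \<one>\<close> by blast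
        ultimately have "card (generate G {h}) = card (generate G {y})"
          using generate_pow_card y(1) hG by simp
        moreover have "generate G {h} \<subseteq> generate G {y}"
          using hy generate_subgroup_incl[OF _ subgroup_generate_singleton[OF y(1)]] by blast
        moreover have "finite (generate G {y})"
          using subgroup.subset[OF subgroup_generate_singleton[OF y(1)]] fin finite_subset by blast
        ultimately have "generate G {h} = generate G {y}" by (simp add: card_subset_eq)
        then have "y \<in> generate G {h}" using generate.incl[of y "{y}" G] by simp
        moreover have "generate G {h} \<subseteq> generate G {z}"
          using hz generate_subgroup_incl[OF _ subgroup_generate_singleton[OF z(1)]] by blast
        ultimately show False using y(3) by blast
      qed
    qed (use y z in \<open>auto intro: subgroup_generate_singleton\<close>)
  qed
qed

end

section \<open>Maps to joins and the mapping index\<close>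

lemma topspace_realization [simp]: "topspace (realization K) = realization_points K"
  by (simp add: realization_def)

lemma continuous_map_realization_coordinate: "continuous_map (realization K) euclideanreal (\<lambda>t. t v)"
  unfolding realization_def
  by (intro continuous_map_from_subtopology continuous_map_product_projection) simp

text \<open>Continuity into the join is obtained from a lift to weights and entries before the
  identification. Such a lift has to provide continuous entries also where the weight
  vanishes.\<close>

lemma continuous_map_join_power:
  assumes "continuous_map Z (powertop_real UNIV) T" "\<And>z. z \<in> topspace Z \<Longrightarrow> T z \<in> standard_simplex k"
    and "continuous_map Z (product_topology (\<lambda>_. X) {..k}) x"
  shows "continuous_map Z (join_power X k) (\<lambda>z. (T z, restrict (x z) {i. 0 < T z i}))"
proof -
  have "continuous_map Z (prod_topology (subtopology (powertop_real UNIV) (standard_simplex k))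
      (product_topology (\<lambda>_. X) {..k})) (\<lambda>z. (T z, x z))"
    using assms by (intro continuous_map_pairedI) (auto simp: continuous_map_in_subtopology)
  then have "continuous_map Z (join_power X k)
      ((\<lambda>(t, x). (t, restrict x {i. 0 < t i})) \<circ> (\<lambda>z. (T z, x z)))"
    unfolding join_power_def
    by (rule continuous_map_compose)
      (rule quotient_imp_continuous_map[OF quotient_map_quotient_topology])
  then show ?thesis by (simp add: o_def)
qed

text \<open>The 0-simplex is one point, with weight one, so E_0 G is the discrete space G. Index 0
  thus means an equivariant locally constant map to G.\<close>

lemma equivariant_map_E_space_0_iff:
  assumes "group G"
  shows "(\<exists>f. equivariant_map G X act (E_space G 0) (E_action G) f) \<longleftrightarrow>
    (\<exists>f. continuous_map X (discrete_topology (carrier G)) f \<and>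
      (\<forall>g\<in>carrier G. \<forall>x\<in>topspace X. f (act g x) = g \<otimes>\<^bsub>G\<^esub> f x))"
    (is "?L \<longleftrightarrow> ?R")
proof
  let ?t0 = "\<lambda>j::nat. if j = 0 then 1 else 0 :: real"
  let ?q = "\<lambda>(t :: nat \<Rightarrow> real, x :: nat \<Rightarrow> 'a). (t, restrict x {i. 0 < t i})"
  let ?P = "prod_topology (subtopology (powertop_real UNIV) (standard_simplex 0))
    (product_topology (\<lambda>_. discrete_topology (carrier G)) {..0::nat})"
  {
    assume ?L
    then obtain f where f: "equivariant_map G X act (E_space G 0) (E_action G) f" by blast
    have q: "quotient_map ?P (E_space G 0) ?q"
      unfolding E_space_def join_power_def by (rule quotient_map_quotient_topology)
    have "continuous_map ?P (discrete_topology (carrier G)) ((\<lambda>y. snd y 0) \<circ> ?q)"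
    proof (rule continuous_map_eq)
      show "continuous_map ?P (discrete_topology (carrier G)) ((\<lambda>x. x (0::nat)) \<circ> snd)"
        by (intro continuous_map_compose[OF continuous_map_snd] continuous_map_product_projection) simp
      fix y assume "y \<in> topspace ?P"
      then have "fst y 0 = 1" by (simp add: standard_simplex_0 mem_Times_iff)
      then show "((\<lambda>x. x (0::nat)) \<circ> snd) y = ((\<lambda>y. snd y 0) \<circ> ?q) y"
        by (simp add: case_prod_unfold)
    qed
    then have p: "continuous_map (E_space G 0) (discrete_topology (carrier G)) (\<lambda>y. snd y 0)"
      by (rule continuous_compose_quotient_map[OF q])
    have "topspace (E_space G 0) = ?q ` topspace ?P"
      unfolding E_space_def join_power_def by (rule topspace_quotient_topology)
    then have act: "snd (E_action G g y) 0 = g \<otimes>\<^bsub>G\<^esub> snd y 0" if "y \<in> topspace (E_space G 0)" for g y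
      using that by (auto simp: standard_simplex_0 E_action_def)
    have fX: "continuous_map X (E_space G 0) f" using f by (simp add: equivariant_map_def)
    show ?R
    proof (intro exI conjI ballI)
      show "continuous_map X (discrete_topology (carrier G)) ((\<lambda>y. snd y 0) \<circ> f)"
        by (rule continuous_map_compose[OF fX p])
      fix g x assume "g \<in> carrier G" "x \<in> topspace X"
      then show "((\<lambda>y. snd y 0) \<circ> f) (act g x) = g \<otimes>\<^bsub>G\<^esub> ((\<lambda>y. snd y 0) \<circ> f) x"
        using f act continuous_map_funspace[OF fX] by (auto simp: equivariant_map_def Pi_iff)
    qed
  next
    assume ?R
    then obtain f where f: "continuous_map X (discrete_topology (carrier G)) f"
      "\<And>g x. g \<in> carrier G \<Longrightarrow> x \<in> topspace X \<Longrightarrow> f (act g x) = g \<otimes>\<^bsub>G\<^esub> f x" by blast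
    have "continuous_map (discrete_topology (carrier G)) (E_space G 0)
        (\<lambda>g. (?t0, restrict (\<lambda>i\<in>{..0}. g) {i. 0 < ?t0 i}))"
      unfolding E_space_def
      by (rule continuous_map_join_power) (auto simp: continuous_map_from_discrete_topology)
    then have "continuous_map X (E_space G 0)
        ((\<lambda>g. (?t0, restrict (\<lambda>i\<in>{..0}. g) {i. 0 < ?t0 i})) \<circ> f)"
      by (rule continuous_map_compose[OF f(1)])
    then show ?L
      using f(2) by (auto simp: equivariant_map_def E_action_def fun_eq_iff restrict_def
          intro!: exI[of _ "(\<lambda>g. (?t0, restrict (\<lambda>i\<in>{..0}. g) {i. 0 < ?t0 i})) \<circ> f"])
  }
qed

lemma mapping_index_eq_0:
  assumes "\<exists>f. equivariant_map G X act (E_space G 0) (E_action G) f"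
  shows "mapping_index G X act = 0"
proof -
  have "mapping_index G X act \<le> enat 0"
    unfolding mapping_index_def using assms by (intro Inf_lower) blast
  then show ?thesis by (simp flip: zero_enat_def)
qed

lemma mapping_index_eq_1:
  assumes "equivariant_map G X act (E_space G 1) (E_action G) f"
    and no: "\<nexists>f. equivariant_map G X act (E_space G 0) (E_action G) f"
  shows "mapping_index G X act = 1"
proof (rule antisym)
  show "mapping_index G X act \<le> 1"
    unfolding mapping_index_def one_enat_def using assms(1) by (intro Inf_lower) blast
  show "1 \<le> mapping_index G X act"
    unfolding mapping_index_def
  proof (rule Inf_greatest)
    fix n assume "n \<in> {enat k |k. \<exists>f. equivariant_map G X act (E_space G k) (E_action G) f}"
    then obtain k where k: "n = enat k" "\<exists>f. equivariant_map G X act (E_space G k) (E_action G) f"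
      by blast
    then have "k \<noteq> 0" using no by metis
    then show "1 \<le> n" by (simp add: k one_enat_def)
  qed
qed

text \<open>Each orbit gets a representative, chosen from the orbit as a set and hence common to all
  its points. Freeness makes the group element \<open>u x\<close> that carries it to x unique, and
  uniqueness gives equivariance.\<close>

lemma (in group) free_action_equivariant_map:
  assumes closed: "\<And>g x. g \<in> carrier G \<Longrightarrow> x \<in> E \<Longrightarrow> act g x \<in> E"
    and one: "\<And>x. x \<in> E \<Longrightarrow> act \<one> x = x"
    and mult: "\<And>g h x. g \<in> carrier G \<Longrightarrow> h \<in> carrier G \<Longrightarrow> x \<in> E \<Longrightarrow> act (g \<otimes> h) x = act g (act h x)"
    and free: "\<And>g x. g \<in> carrier G \<Longrightarrow> x \<in> E \<Longrightarrow> act g x = x \<Longrightarrow> g = \<one>"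
  obtains u where "u \<in> E \<rightarrow> carrier G"
    "\<And>g x. g \<in> carrier G \<Longrightarrow> x \<in> E \<Longrightarrow> u (act g x) = g \<otimes> u x"
proof -
  define orb where "orb x = {act g x | g. g \<in> carrier G}" for x
  define r where "r x = (SOME y. y \<in> orb x)" for x
  define u where "u x = (SOME g. g \<in> carrier G \<and> act g (r x) = x)" for x
  have orb_act: "orb (act g x) = orb x" if gx: "g \<in> carrier G" "x \<in> E" for g x
  proof (intro equalityI subsetI)
    fix y assume "y \<in> orb (act g x)"
    then obtain h where "h \<in> carrier G" "y = act (h \<otimes> g) x" using gx mult by (auto simp: orb_def)
    then show "y \<in> orb x" using that by (auto simp: orb_def)
  next
    fix y assume "y \<in> orb x"
    then obtain h where h: "h \<in> carrier G" "y = act h x" by (auto simp: orb_def)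
    have "act (h \<otimes> inv g) (act g x) = act (h \<otimes> inv g \<otimes> g) x"
      using that h by (simp add: mult)
    then have "y = act (h \<otimes> inv g) (act g x)" using that h by (simp add: m_assoc)
    then show "y \<in> orb (act g x)" using that h by (auto simp: orb_def)
  qed
  have r: "r x \<in> orb x" if "x \<in> E" for x
  proof -
    have "act \<one> x \<in> orb x" by (auto simp: orb_def)
    then show ?thesis unfolding r_def by (rule someI)
  qed
  have rE: "r x \<in> E" if "x \<in> E" for x using r[OF that] closed that by (auto simp: orb_def)
  have u: "u x \<in> carrier G \<and> act (u x) (r x) = x" if x: "x \<in> E" for x
  proof -
    obtain h where h: "h \<in> carrier G" "r x = act h x" using r[OF x] by (auto simp: orb_def)
    have "act (inv h) (r x) = act (inv h \<otimes> h) x" using h(1) x by (simp only: h(2) mult inv_closed)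
    then have "inv h \<in> carrier G \<and> act (inv h) (r x) = x" using h x by (simp add: one)
    then show ?thesis unfolding u_def by (rule someI)
  qed
  have inj: "g = h" if "g \<in> carrier G" "h \<in> carrier G" "x \<in> E" "act g x = act h x" for g h x
  proof -
    have "act (inv h \<otimes> g) x = act (inv h) (act h x)" using that by (simp add: mult)
    also have "\<dots> = act (inv h \<otimes> h) x" using that by (simp only: mult inv_closed)
    also have "\<dots> = x" using that by (simp add: one)
    finally have "inv h \<otimes> g = \<one>" using that free by simp
    then have "h \<otimes> (inv h \<otimes> g) = h" using that by simp
    then show ?thesis using that by (simp add: inv_cancel)
  qed
  show thesis
  proof
    show "u \<in> E \<rightarrow> carrier G" using u by blast
    fix g x assume gx: "g \<in> carrier G" "x \<in> E"
    have "r (act g x) = r x" using orb_act[OF gx] by (simp add: r_def)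
    then have "act (u (act g x)) (r x) = act (g \<otimes> u x) (r x)"
      using u[OF gx(2)] u[OF closed[OF gx]] gx rE by (simp add: mult)
    then show "u (act g x) = g \<otimes> u x"
      using inj u[OF gx(2)] u[OF closed[OF gx]] gx rE by blast
  qed
qed

section \<open>Graphs of cosets\<close>

text \<open>Vertices are two coloured copies of G. The encoding \<open>e\<close> into an arbitrary
  type allows natural numbers as vertices in the final statement.\<close>

locale coset_graph = group +
  fixes H and e :: "'a \<times> bool \<Rightarrow> 'v"
  assumes finite_carrier: "finite (carrier G)" and subgroup_H: "subgroup H G"
    and inj_e: "inj_on e (carrier G \<times> UNIV)"
begin

definition verts :: "'v set" where
  "verts = e ` (carrier G \<times> UNIV)"

text \<open>Edges join exactly the vertices of different colour in the same left coset of H: one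
  complete bipartite graph, the join H * H, for each coset.\<close>

definition simplices :: "'v set set" where
  "simplices = {s. s \<noteq> {} \<and> (\<exists>g\<in>carrier G. \<exists>h\<in>H. s \<subseteq> {e (g, False), e (g \<otimes> h, True)})}"

definition label :: "'v \<Rightarrow> 'a \<times> bool" where
  "label = inv_into (carrier G \<times> UNIV) e"

definition act :: "'a \<Rightarrow> 'v \<Rightarrow> 'v" where
  "act g = (\<lambda>v\<in>verts. e (g \<otimes> fst (label v), snd (label v)))"

lemma H_carrier: "h \<in> H \<Longrightarrow> h \<in> carrier G"
  by (rule subgroup.mem_carrier[OF subgroup_H])

lemma label_e [simp]: "g \<in> carrier G \<Longrightarrow> label (e (g, b)) = (g, b)"
  unfolding label_def using inj_e by (simp add: inv_into_f_f)

lemma e_in_verts [simp]: "g \<in> carrier G \<Longrightarrow> e (g, b) \<in> verts"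
  by (simp add: verts_def)

lemma vertsE:
  assumes "v \<in> verts"
  obtains g b where "g \<in> carrier G" "v = e (g, b)"
  using assms by (auto simp: verts_def)

lemma e_eq_iff: "g \<in> carrier G \<Longrightarrow> g' \<in> carrier G \<Longrightarrow> e (g, b) = e (g', b') \<longleftrightarrow> g = g' \<and> b = b'"
  using inj_e by (auto simp: inj_on_def)

lemma act_e [simp]: "g \<in> carrier G \<Longrightarrow> g' \<in> carrier G \<Longrightarrow> act g (e (g', b)) = e (g \<otimes> g', b)"
  by (simp add: act_def)

lemma Union_simplices: "\<Union> simplices = verts"
proof
  show "\<Union> simplices \<subseteq> verts"
    using H_carrier by (auto simp: simplices_def)
  show "verts \<subseteq> \<Union> simplices"
  proof
    fix v assume "v \<in> verts"
    then obtain g b where g: "g \<in> carrier G" "v = e (g, b)" by (rule vertsE)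
    then have "{v} \<subseteq> {e (g, False), e (g \<otimes> \<one>, True)}" by (cases b) auto
    then have "{v} \<in> simplices"
      using g(1) subgroup.one_closed[OF subgroup_H] unfolding simplices_def by blast
    then show "v \<in> \<Union> simplices" by blast
  qed
qed

lemma finite_verts: "finite verts"
  using finite_carrier by (simp add: verts_def)

lemma abstract_complex_simplices: "abstract_complex simplices"
  unfolding abstract_complex_def
proof (intro conjI ballI allI impI)
  fix s assume "s \<in> simplices"
  then show "finite s" "s \<noteq> {}" by (auto simp: simplices_def intro: finite_subset)
next
  fix s s' assume "s \<in> simplices" "s' \<subseteq> s \<and> s' \<noteq> {}"
  then show "s' \<in> simplices" unfolding simplices_def by blast
qed

lemma finite_simplices: "finite simplices"
proof (rule finite_subset)
  show "simplices \<subseteq> Pow verts" using Union_simplices by blast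
qed (simp add: finite_verts)

lemma group_action_act: "group_action G verts act"
proof (rule group_actionI)
  show "act g \<in> extensional verts" for g by (simp add: act_def)
qed (auto elim!: vertsE simp: m_assoc)

lemma simplicial_action_act: "simplicial_action G simplices act"
  unfolding simplicial_action_def Union_simplices
proof (intro conjI group_action_act ballI)
  fix g s assume g: "g \<in> carrier G" and "s \<in> simplices"
  then obtain g0 h where s: "s \<noteq> {}" "g0 \<in> carrier G" "h \<in> H" "s \<subseteq> {e (g0, False), e (g0 \<otimes> h, True)}"
    by (auto simp: simplices_def)
  have "act g ` s \<subseteq> act g ` {e (g0, False), e (g0 \<otimes> h, True)}" using s by blast
  also have "\<dots> = {e (g \<otimes> g0, False), e (g \<otimes> g0 \<otimes> h, True)}"
    using g s H_carrier by (simp add: m_assoc)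
  finally show "act g ` s \<in> simplices"
    using g s unfolding simplices_def by blast
qed

section \<open>The realization described edge by edge, and freeness of the action\<close>

definition on_edge :: "'a \<Rightarrow> 'a \<Rightarrow> ('v \<Rightarrow> real) \<Rightarrow> bool" where
  "on_edge g h t \<longleftrightarrow> (\<forall>v. 0 \<le> t v) \<and> (\<forall>v. v \<noteq> e (g, False) \<longrightarrow> v \<noteq> e (g \<otimes> h, True) \<longrightarrow> t v = 0)
     \<and> t (e (g, False)) + t (e (g \<otimes> h, True)) = 1"

lemma on_edge_support:
  assumes "on_edge g h t" "t (e (k, b)) \<noteq> 0" "g \<in> carrier G" "h \<in> H" "k \<in> carrier G"
  shows "k = (if b then g \<otimes> h else g)"
  using assms H_carrier unfolding on_edge_def by (metis e_eq_iff m_closed)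

lemma realization_points_simplices:
  "realization_points simplices = {t. \<exists>g\<in>carrier G. \<exists>h\<in>H. on_edge g h t}"
proof (intro equalityI subsetI)
  fix t assume t: "t \<in> realization_points simplices"
  then obtain g h where gh: "g \<in> carrier G" "h \<in> H" "{v. t v \<noteq> 0} \<subseteq> {e (g, False), e (g \<otimes> h, True)}"
    by (auto simp: realization_points_def simplices_def)
  have "(\<Sum>v\<in>{v. t v \<noteq> 0}. t v) = (\<Sum>v\<in>{e (g, False), e (g \<otimes> h, True)}. t v)"
    using gh(3) by (intro sum.mono_neutral_left) auto
  moreover have "e (g, False) \<noteq> e (g \<otimes> h, True)" using gh H_carrier by (simp add: e_eq_iff)
  ultimately have "on_edge g h t"
    using t gh(3) by (auto simp: realization_points_def on_edge_def)
  then show "t \<in> {t. \<exists>g\<in>carrier G. \<exists>h\<in>H. on_edge g h t}" using gh by blast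
next
  fix t assume "t \<in> {t. \<exists>g\<in>carrier G. \<exists>h\<in>H. on_edge g h t}"
  then obtain g h where gh: "g \<in> carrier G" "h \<in> H" "on_edge g h t" by blast
  have sub: "{v. t v \<noteq> 0} \<subseteq> {e (g, False), e (g \<otimes> h, True)}"
    using gh(3) by (auto simp: on_edge_def)
  then have "(\<Sum>v\<in>{v. t v \<noteq> 0}. t v) = (\<Sum>v\<in>{e (g, False), e (g \<otimes> h, True)}. t v)"
    by (intro sum.mono_neutral_left) auto
  moreover have "e (g, False) \<noteq> e (g \<otimes> h, True)" using gh H_carrier by (simp add: e_eq_iff)
  ultimately have "(\<Sum>v\<in>{v. t v \<noteq> 0}. t v) = 1" using gh(3) by (simp add: on_edge_def)
  moreover from this have "{v. t v \<noteq> 0} \<noteq> {}" by (metis sum.empty zero_neq_one)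
  ultimately show "t \<in> realization_points simplices"
    using gh sub by (auto simp: realization_points_def simplices_def on_edge_def)
qed

lemma realization_action_e:
  assumes "g \<in> carrier G" "g' \<in> carrier G"
  shows "realization_action simplices act g t (e (g', b)) = t (e (inv g \<otimes> g', b))"
proof -
  have "{v \<in> verts. act g v = e (g', b)} = {e (inv g \<otimes> g', b)}"
    using assms by (auto elim!: vertsE simp: e_eq_iff inv_cancel)
  then show ?thesis by (simp add: affine_extension_def Union_simplices)
qed

lemma realization_action_outside:
  assumes "g \<in> carrier G" "w \<notin> verts"
  shows "realization_action simplices act g t w = 0"
proof -
  have "{v \<in> verts. act g v = w} = {}"
    using assms by (auto elim!: vertsE)
  then show ?thesis unfolding affine_extension_def Union_simplices by (simp only: sum.empty)
qed

lemma on_edge_action: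
  assumes g: "g \<in> carrier G" and g0: "g0 \<in> carrier G" and h: "h \<in> H" and t: "on_edge g0 h t"
  shows "on_edge (g \<otimes> g0) h (realization_action simplices act g t)"
proof -
  have hG: "h \<in> carrier G" by (rule H_carrier[OF h])
  have "realization_action simplices act g t v = 0"
    if v: "v \<noteq> e (g \<otimes> g0, False)" "v \<noteq> e (g \<otimes> g0 \<otimes> h, True)" for v
  proof (cases "v \<in> verts")
    case True
    then obtain k b where k: "k \<in> carrier G" "v = e (k, b)" by (rule vertsE)
    have "k = g \<otimes> (inv g \<otimes> k)" using k g by (simp add: inv_cancel)
    then have "inv g \<otimes> k \<noteq> g0 \<or> b" "inv g \<otimes> k \<noteq> g0 \<otimes> h \<or> \<not> b"
      using v k g g0 hG m_assoc[of g g0 h] by metis+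
    then show ?thesis
      using t g g0 hG k by (auto simp: realization_action_e on_edge_def e_eq_iff)
  qed (use g in \<open>simp add: realization_action_outside\<close>)
  moreover have "0 \<le> realization_action simplices act g t v" for v
    using t by (auto simp: affine_extension_def on_edge_def intro: sum_nonneg)
  ultimately show ?thesis
    using t g g0 hG by (simp add: on_edge_def realization_action_e m_assoc inv_cancel)
qed

text \<open>An edge has one end of each colour, so a symmetry fixing a point of it fixes a vertex.\<close>

lemma free_on_realization: "free_on G (realization simplices) (realization_action simplices act)"
  unfolding free_on_def
proof (intro ballI impI notI)
  fix g t assume g: "g \<in> carrier G" "g \<noteq> \<one>" and t: "t \<in> topspace (realization simplices)"
    and fixed: "realization_action simplices act g t = t"
  from t obtain g0 h where gh: "g0 \<in> carrier G" "h \<in> H" "on_edge g0 h t"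
    by (auto simp: realization_points_simplices)
  have hG: "h \<in> carrier G" by (rule H_carrier[OF gh(2)])
  have inv: "t (e (inv g \<otimes> k, b)) = t (e (k, b))" if "k \<in> carrier G" for k b
    using realization_action_e[OF g(1) that, of t b] fixed by simp
  have ne: "inv g \<otimes> k \<noteq> k" if "k \<in> carrier G" for k
    using g that by simp
  have zero: "t (e (k, b)) = 0" if k: "k \<in> carrier G" "k = (if b then g0 \<otimes> h else g0)" for k b
  proof (rule ccontr)
    assume "t (e (k, b)) \<noteq> 0"
    then have "t (e (inv g \<otimes> k, b)) \<noteq> 0" by (simp only: inv[OF k(1)] not_False_eq_True)
    then have "inv g \<otimes> k = (if b then g0 \<otimes> h else g0)"
      by (rule on_edge_support[OF gh(3) _ gh(1,2)]) (use g k in simp)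
    then show False using ne[OF k(1)] k(2) by metis
  qed
  have "t (e (g0, False)) = 0" "t (e (g0 \<otimes> h, True)) = 0"
    by (rule zero; use gh(1) hG in simp)+
  then show False using gh(3) by (simp add: on_edge_def)
qed

lemma finite_free_complex_simplices: "finite_free_complex G simplices act"
  unfolding finite_free_complex_def
  using abstract_complex_simplices finite_simplices simplicial_action_act free_on_realization by blast

section \<open>The equivariant map to the join G * G\<close>

definition join_weight :: "('v \<Rightarrow> real) \<Rightarrow> nat \<Rightarrow> real" where
  "join_weight t i = (if i \<le> 1 then \<Sum>g\<in>carrier G. t (e (g, i = 1)) else 0)"

text \<open>On an edge at most one vertex of each colour carries mass, so the choice is forced where
  the weight is positive; its value elsewhere is discarded by \<open>to_join\<close>.\<close>

definition join_entry :: "('v \<Rightarrow> real) \<Rightarrow> nat \<Rightarrow> 'a" where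
  "join_entry t i = (SOME g. g \<in> carrier G \<and> t (e (g, i = 1)) \<noteq> 0)"

definition to_join :: "('v \<Rightarrow> real) \<Rightarrow> (nat \<Rightarrow> real) \<times> (nat \<Rightarrow> 'a)" where
  "to_join t = (join_weight t, \<lambda>i\<in>{i. 0 < join_weight t i}. join_entry t i)"

lemma join_weight_on_edge:
  assumes "g \<in> carrier G" "h \<in> H" "on_edge g h t"
  shows "join_weight t = (\<lambda>i. if i = 0 then t (e (g, False)) else if i = 1 then t (e (g \<otimes> h, True)) else 0)"
proof
  have hG: "h \<in> carrier G" by (rule H_carrier[OF assms(2)])
  have "(\<Sum>k\<in>carrier G. t (e (k, False))) = (\<Sum>k\<in>{g}. t (e (k, False)))"
    using assms hG finite_carrier by (intro sum.mono_neutral_right) (auto simp: on_edge_def e_eq_iff)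
  moreover have "(\<Sum>k\<in>carrier G. t (e (k, True))) = (\<Sum>k\<in>{g \<otimes> h}. t (e (k, True)))"
    using assms hG finite_carrier by (intro sum.mono_neutral_right) (auto simp: on_edge_def e_eq_iff)
  ultimately show "join_weight t i = (if i = 0 then t (e (g, False)) else if i = 1 then t (e (g \<otimes> h, True)) else 0)" for i
    by (auto simp: join_weight_def)
qed

lemma to_join_on_edge:
  assumes "g \<in> carrier G" "h \<in> H" "on_edge g h t"
  shows "to_join t = (join_weight t, \<lambda>i\<in>{i. 0 < join_weight t i}. if i = 0 then g else g \<otimes> h)"
proof -
  have hG: "h \<in> carrier G" by (rule H_carrier[OF assms(2)])
  have "join_entry t i = (if i = 0 then g else g \<otimes> h)" if "0 < join_weight t i" for i
  proof -
    have i: "i = 0 \<or> i = 1" using that by (auto simp: join_weight_def split: if_splits)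
    show ?thesis unfolding join_entry_def
      using i that assms hG
      on_edge_support[OF assms(3) _ assms(1,2), where b = False]
      on_edge_support[OF assms(3) _ assms(1,2), where b = True]
      by (intro some_equality) (auto simp: join_weight_on_edge split: if_splits)
  qed
  then show ?thesis by (auto simp: to_join_def)
qed

lemma join_weight_in_standard_simplex:
  assumes "g \<in> carrier G" "h \<in> H" "on_edge g h t"
  shows "join_weight t \<in> standard_simplex 1"
proof -
  have "0 \<le> t (e (g, False))" "0 \<le> t (e (g \<otimes> h, True))" "t (e (g, False)) + t (e (g \<otimes> h, True)) = 1"
    using assms(3) by (auto simp: on_edge_def)
  then show ?thesis
    unfolding join_weight_on_edge[OF assms] by (auto simp: standard_simplex_def)
qed

text \<open>The entries are constant along an edge but may change from one edge to the next at a
  vertex, where their weight vanishes. Continuity is therefore proved on each closed edge, with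
  constant entries as the lift, and pasted over the finitely many edges.\<close>

lemma equivariant_map_to_join:
  "equivariant_map G (realization simplices) (realization_action simplices act)
     (E_space G 1) (E_action G) to_join"
  unfolding equivariant_map_def
proof (intro conjI ballI)
  fix g t assume g: "g \<in> carrier G" and t: "t \<in> topspace (realization simplices)"
  then obtain g0 h where gh: "g0 \<in> carrier G" "h \<in> H" "on_edge g0 h t"
    by (auto simp: realization_points_simplices)
  have hG: "h \<in> carrier G" by (rule H_carrier[OF gh(2)])
  let ?gt = "realization_action simplices act g t"
  have e: "on_edge (g \<otimes> g0) h ?gt" using on_edge_action[OF g gh] .
  have w: "join_weight ?gt = join_weight t"
    using join_weight_on_edge[OF gh] join_weight_on_edge[OF _ gh(2) e] g gh hG
    by (simp add: realization_action_e inv_cancel m_assoc cong: if_cong)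
  show "to_join ?gt = E_action G g (to_join t)"
    using to_join_on_edge[OF gh] to_join_on_edge[OF _ gh(2) e] g gh(1) hG
    by (auto simp: w E_action_def m_assoc)
next
  have cont_weight: "continuous_map (realization simplices) (powertop_real UNIV) join_weight"
    unfolding continuous_map_componentwise_UNIV join_weight_def
    by (auto intro!: continuous_map_sum finite_carrier continuous_map_realization_coordinate)
  let ?S = "\<lambda>(g, h). {t \<in> topspace (realization simplices). on_edge g h t}"
  show "continuous_map (realization simplices) (E_space G 1) to_join"
  proof (rule pasting_lemma_closed[where I = "carrier G \<times> H" and f = "\<lambda>_. to_join" and T = ?S])
    show "finite (carrier G \<times> H)"
      using finite_carrier subgroup.subset[OF subgroup_H] finite_subset by blast
    show "\<exists>j. j \<in> carrier G \<times> H \<and> t \<in> ?S j \<and> to_join t = to_join t"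
      if "t \<in> topspace (realization simplices)" for t
      using that by (auto simp: realization_points_simplices)
  next
    fix i assume "i \<in> carrier G \<times> H"
    then obtain g h where i: "i = (g, h)" "g \<in> carrier G" "h \<in> H" by auto
    have hG: "h \<in> carrier G" by (rule H_carrier[OF i(3)])
    \<comment> \<open>Within the realization a closed edge is cut out by one equation, namely that
      its two ends carry total mass one; this makes it a closed set.\<close>
    have "on_edge g h t"
      if t: "t \<in> realization_points simplices" "t (e (g, False)) + t (e (g \<otimes> h, True)) = 1" for t
    proof -
      obtain g' h' where e': "g' \<in> carrier G" "h' \<in> H" "on_edge g' h' t"
        using t(1) by (auto simp: realization_points_simplices)
      note supp = on_edge_support[OF e'(3) _ e'(1,2)]
      have "t v = 0" if v: "v \<noteq> e (g, False)" "v \<noteq> e (g \<otimes> h, True)" for v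
      proof (rule ccontr)
        assume "t v \<noteq> 0"
        then have "v = e (g', False) \<or> v = e (g' \<otimes> h', True)" using e'(3) by (auto simp: on_edge_def)
        then show False
        proof
          assume v': "v = e (g', False)"
          then have "t (e (g, False)) = 0" using supp[of g False] v i by auto
          then have "t (e (g \<otimes> h, True)) = 1" using t(2) by simp
          moreover from this have "g \<otimes> h = g' \<otimes> h'" using supp[of "g \<otimes> h" True] i hG by simp
          ultimately show False using e'(3) v' \<open>t v \<noteq> 0\<close> by (simp add: on_edge_def)
        next
          assume v': "v = e (g' \<otimes> h', True)"
          have "g \<otimes> h \<in> carrier G" using i hG by simp
          then have "t (e (g \<otimes> h, True)) = 0" using supp[of "g \<otimes> h" True] v(2) v' by metis
          then have "t (e (g, False)) = 1" using t(2) by simp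
          moreover from this have "g = g'" using supp[of g False] i by simp
          ultimately show False using e'(3) v' \<open>t v \<noteq> 0\<close> by (simp add: on_edge_def)
        qed
      qed
      then show ?thesis using t(2) e'(3) by (simp add: on_edge_def)
    qed
    then have "?S i = {t \<in> topspace (realization simplices). t (e (g, False)) + t (e (g \<otimes> h, True)) \<in> {1}}"
      using i by (auto simp: on_edge_def)
    also have "closedin (realization simplices) \<dots>"
      by (rule closedin_continuous_map_preimage[where Y = euclideanreal])
        (intro continuous_map_add continuous_map_realization_coordinate, simp)
    finally show "closedin (realization simplices) (?S i)" .
    let ?x = "\<lambda>i\<in>{..1::nat}. if i = 0 then g else g \<otimes> h"
    show "continuous_map (subtopology (realization simplices) (?S i)) (E_space G 1) to_join"
    proof (rule continuous_map_eq)
      show "continuous_map (subtopology (realization simplices) (?S i)) (E_space G 1)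
          (\<lambda>t. (join_weight t, restrict ?x {i. 0 < join_weight t i}))"
        unfolding E_space_def
      proof (rule continuous_map_join_power)
        show "join_weight t \<in> standard_simplex 1"
          if "t \<in> topspace (subtopology (realization simplices) (?S i))" for t
          using that i join_weight_in_standard_simplex by auto
        show "continuous_map (subtopology (realization simplices) (?S i))
            (product_topology (\<lambda>_. discrete_topology (carrier G)) {..1}) (\<lambda>t. ?x)"
          using i hG by (auto simp: continuous_map_const)
      qed (intro continuous_map_from_subtopology cont_weight)
    next
      fix t assume "t \<in> topspace (subtopology (realization simplices) (?S i))"
      then have t: "on_edge g h t" using i by simp
      have "i \<le> 1" if "0 < join_weight t i" for i
        using that by (auto simp: join_weight_def split: if_splits)
      then show "(join_weight t, restrict ?x {i. 0 < join_weight t i}) = to_join t"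
        unfolding to_join_on_edge[OF i(2,3) t] by (auto simp: restrict_def fun_eq_iff)
    qed
  qed auto
qed

section \<open>Absence of an equivariant map to G\<close>

definition vertex_point :: "'a \<Rightarrow> bool \<Rightarrow> 'v \<Rightarrow> real" where
  "vertex_point g b = (\<lambda>w. if w = e (g, b) then 1 else 0)"

lemma vertex_point_action:
  assumes "g \<in> carrier G" "k \<in> carrier G"
  shows "realization_action simplices act g (vertex_point k b) = vertex_point (g \<otimes> k) b"
proof
  fix w
  show "realization_action simplices act g (vertex_point k b) w = vertex_point (g \<otimes> k) b w"
  proof (cases "w \<in> verts")
    case True
    then obtain l c where l: "l \<in> carrier G" "w = e (l, c)" by (rule vertsE)
    have "inv g \<otimes> l = k \<longleftrightarrow> l = g \<otimes> k" using assms l by (auto simp: inv_cancel)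
    then show ?thesis using assms l by (simp add: realization_action_e vertex_point_def e_eq_iff)
  next
    case False
    then show ?thesis
      using assms by (auto simp: realization_action_outside vertex_point_def)
  qed
qed

lemma vertex_point_in_realization:
  assumes "g \<in> carrier G"
  shows "vertex_point g False \<in> realization_points simplices"
proof -
  have "on_edge g \<one> (vertex_point g False)"
    using assms by (auto simp: on_edge_def vertex_point_def e_eq_iff)
  then show ?thesis
    using assms subgroup.one_closed[OF subgroup_H] by (auto simp: realization_points_simplices)
qed

text \<open>The edge is a continuous image of the unit interval, and a connected subset of a
  discrete space has at most one point.\<close>

lemma discrete_map_constant_on_edge:
  assumes f: "continuous_map (realization simplices) (discrete_topology D) f"
    and g: "g \<in> carrier G" and h: "h \<in> H"
  shows "f (vertex_point g False) = f (vertex_point (g \<otimes> h) True)"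
proof -
  define u :: "real \<Rightarrow> 'v \<Rightarrow> real" where
    "u s = (\<lambda>v. if v = e (g, False) then 1 - s else if v = e (g \<otimes> h, True) then s else 0)" for s
  have ne: "e (g, False) \<noteq> e (g \<otimes> h, True)" using g H_carrier[OF h] by (simp add: e_eq_iff)
  have "continuous_map (top_of_set {0..1}) (powertop_real UNIV) u"
    unfolding continuous_map_componentwise_UNIV
  proof
    fix v
    show "continuous_map (top_of_set {0..1}) euclideanreal (\<lambda>s. u s v)"
      by (cases "v = e (g, False)"; cases "v = e (g \<otimes> h, True)")
        (auto simp: u_def intro!: continuous_intros)
  qed
  moreover have "u s \<in> realization_points simplices" if "s \<in> {0..1}" for s
  proof -
    have "on_edge g h (u s)" using that ne by (auto simp: on_edge_def u_def)
    then show ?thesis using g h unfolding realization_points_simplices by blast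
  qed
  ultimately have "continuous_map (top_of_set {0..1}) (realization simplices) u"
    by (simp add: realization_def continuous_map_in_subtopology Pi_iff)
  then have "continuous_map (top_of_set {0..1}) (discrete_topology D) (f \<circ> u)"
    using f by (rule continuous_map_compose)
  then have "connectedin (discrete_topology D) ((f \<circ> u) ` {0..1})"
    by (rule connectedin_continuous_map_image) (simp add: connectedin_subtopology)
  then obtain a where "(f \<circ> u) ` {0..1} \<subseteq> {a}" by (auto simp: connectedin_discrete_topology)
  then have "f (u 0) = f (u 1)" by (auto simp: image_subset_iff)
  moreover have "u 0 = vertex_point g False" "u 1 = vertex_point (g \<otimes> h) True"
    using ne by (auto simp: u_def vertex_point_def)
  ultimately show ?thesis by simp
qed

lemma mapping_index_realization:
  assumes "H \<noteq> {\<one>}"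
  shows "mapping_index G (realization simplices) (realization_action simplices act) = 1"
proof (rule mapping_index_eq_1[OF equivariant_map_to_join])
  show "\<nexists>f. equivariant_map G (realization simplices) (realization_action simplices act)
      (E_space G 0) (E_action G) f"
    unfolding equivariant_map_E_space_0_iff[OF is_group]
  proof
    assume "\<exists>f. continuous_map (realization simplices) (discrete_topology (carrier G)) f \<and>
      (\<forall>g\<in>carrier G. \<forall>x\<in>topspace (realization simplices).
        f (realization_action simplices act g x) = g \<otimes> f x)"
    then obtain f where f: "continuous_map (realization simplices) (discrete_topology (carrier G)) f"
      "\<And>g x. g \<in> carrier G \<Longrightarrow> x \<in> realization_points simplices \<Longrightarrow>
        f (realization_action simplices act g x) = g \<otimes> f x" by auto
    obtain h where h: "h \<in> H" "h \<noteq> \<one>"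
      using assms subgroup.one_closed[OF subgroup_H] by blast
    have hG: "h \<in> carrier G" by (rule H_carrier[OF h(1)])
    have "f (vertex_point \<one> False) = f (vertex_point \<one> True)"
      using discrete_map_constant_on_edge[OF f(1) one_closed subgroup.one_closed[OF subgroup_H]] by simp
    \<comment> \<open>The second edge of the path starts at h and has step \<open>inv h\<close>, so
      that it ends in the vertex of the identity. The path joins two points of one orbit that differ
      by h.\<close>
    also have "\<dots> = f (vertex_point h False)"
      using discrete_map_constant_on_edge[OF f(1) hG subgroup.m_inv_closed[OF subgroup_H h(1)]] hG by simp
    also have "\<dots> = h \<otimes> f (vertex_point \<one> False)"
      using f(2)[OF hG vertex_point_in_realization[OF one_closed]] hG by (simp add: vertex_point_action)
    finally have "f (vertex_point \<one> False) = h \<otimes> f (vertex_point \<one> False)" .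
    moreover have "f (vertex_point \<one> False) \<in> carrier G"
      using continuous_map_funspace[OF f(1)] vertex_point_in_realization[OF one_closed] by auto
    ultimately show False using h(2) hG by (metis r_cancel_one)
  qed
qed

section \<open>The locally constant map to left cosets\<close>

definition coset_of :: "('v \<Rightarrow> real) \<Rightarrow> 'a set" where
  "coset_of t = (\<Union>v\<in>{v. t v \<noteq> 0}. fst (label v) <# H)"

lemma l_coset_mult_subgroup:
  assumes "g \<in> carrier G" "h \<in> H"
  shows "(g \<otimes> h) <# H = g <# H"
  using assms H_carrier subgroup_H coset_join3 lcos_m_assoc subgroup.subset by metis

lemma on_edge_vertex_coset:
  assumes "g \<in> carrier G" "h \<in> H" "on_edge g h t" "t v \<noteq> 0"
  shows "v \<in> verts" "fst (label v) <# H = g <# H"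
proof -
  have "v = e (g, False) \<or> v = e (g \<otimes> h, True)" using assms by (auto simp: on_edge_def)
  then show "v \<in> verts" "fst (label v) <# H = g <# H"
    using assms H_carrier by (auto simp: l_coset_mult_subgroup)
qed

lemma on_edge_nonzero:
  assumes "on_edge g h t"
  obtains v where "t v \<noteq> 0"
  using assms by (fastforce simp: on_edge_def)

text \<open>Both ends of an edge lie in the same left coset, so the union in \<open>coset_of\<close>
  has equal members; it spares the choice of a vertex in the support.\<close>

lemma coset_of_on_edge:
  assumes "g \<in> carrier G" "h \<in> H" "on_edge g h t"
  shows "coset_of t = g <# H"
proof -
  obtain v where "t v \<noteq> 0" using assms(3) by (rule on_edge_nonzero)
  then have "{v. t v \<noteq> 0} \<noteq> {}" by blast
  moreover have "fst (label v) <# H = g <# H" if "v \<in> {v. t v \<noteq> 0}" for v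
    using on_edge_vertex_coset[OF assms] that by blast
  ultimately show ?thesis unfolding coset_of_def by blast
qed

lemma coset_of_action:
  assumes "g \<in> carrier G" "t \<in> realization_points simplices"
  shows "coset_of (realization_action simplices act g t) = g <# coset_of t"
proof -
  obtain g0 h where gh: "g0 \<in> carrier G" "h \<in> H" "on_edge g0 h t"
    using assms(2) by (auto simp: realization_points_simplices)
  show ?thesis
    using coset_of_on_edge[OF gh] coset_of_on_edge[OF _ gh(2) on_edge_action[OF assms(1) gh]]
      assms(1) gh(1) subgroup.subset[OF subgroup_H] by (simp add: lcos_m_assoc)
qed

lemma continuous_map_coset_of:
  "continuous_map (realization simplices) (discrete_topology ((\<lambda>g. g <# H) ` carrier G)) coset_of"
  unfolding continuous_map_def
proof (intro conjI allI impI)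
  show "coset_of \<in> topspace (realization simplices)
      \<rightarrow> topspace (discrete_topology ((\<lambda>g. g <# H) ` carrier G))"
    using coset_of_on_edge by (fastforce simp: realization_points_simplices)
next
  fix U assume "openin (discrete_topology ((\<lambda>g. g <# H) ` carrier G)) U"
  \<comment> \<open>The preimage is the union of the open stars of the vertices whose coset belongs
    to U.\<close>
  have "{t \<in> topspace (realization simplices). coset_of t \<in> U} =
      (\<Union>v\<in>{v \<in> verts. fst (label v) <# H \<in> U}. {t \<in> topspace (realization simplices). t v \<in> - {0}})"
    (is "?L = ?R")
  proof (intro equalityI subsetI)
    fix t assume t: "t \<in> ?L"
    then obtain g h where gh: "g \<in> carrier G" "h \<in> H" "on_edge g h t"
      by (auto simp: realization_points_simplices)
    obtain v where v: "t v \<noteq> 0" using gh(3) by (rule on_edge_nonzero)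
    then show "t \<in> ?R"
      using t on_edge_vertex_coset[OF gh v] coset_of_on_edge[OF gh] by auto
  next
    fix t assume t: "t \<in> ?R"
    then obtain g h where gh: "g \<in> carrier G" "h \<in> H" "on_edge g h t"
      by (auto simp: realization_points_simplices)
    then show "t \<in> ?L"
      using t on_edge_vertex_coset[OF gh] coset_of_on_edge[OF gh] by auto
  qed
  also have "openin (realization simplices) \<dots>"
  proof (rule openin_Union, safe)
    fix v
    have "openin euclideanreal (- {0 :: real})" by (simp add: open_Compl)
    then show "openin (realization simplices) {t \<in> topspace (realization simplices). t v \<in> - {0}}"
      by (rule openin_continuous_map_preimage[OF continuous_map_realization_coordinate])
  qed
  finally show "openin (realization simplices) {t \<in> topspace (realization simplices). coset_of t \<in> U}" .
qed

end

text \<open>The two coset maps together are a locally constant equivariant map to the finite G-set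
  of pairs of cosets. This G-set is free, so it maps on to G.\<close>

lemma (in group) mapping_index_product_coset_graphs:
  assumes K1: "coset_graph G H1 e1" and K2: "coset_graph G H2 e2"
    and disj: "\<And>g h. g \<in> carrier G \<Longrightarrow> h \<in> H1 \<Longrightarrow> g \<otimes> h \<otimes> inv g \<in> H2 \<Longrightarrow> h = \<one>"
  defines "S1 \<equiv> coset_graph.simplices G H1 e1" and "S2 \<equiv> coset_graph.simplices G H2 e2"
    and "\<phi>1 \<equiv> coset_graph.act G e1" and "\<phi>2 \<equiv> coset_graph.act G e2"
  shows "mapping_index G (prod_topology (realization S1) (realization S2))
    (diagonal_action (realization_action S1 \<phi>1) (realization_action S2 \<phi>2)) = 0"
proof (rule mapping_index_eq_0)
  interpret K1: coset_graph G H1 e1 by (rule K1)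
  interpret K2: coset_graph G H2 e2 by (rule K2)
  have H1: "H1 \<subseteq> carrier G" and H2: "H2 \<subseteq> carrier G"
    using K1.subgroup_H K2.subgroup_H by (simp_all add: subgroup.subset)
  define C1 where "C1 = (\<lambda>g. g <# H1) ` carrier G"
  define C2 where "C2 = (\<lambda>g. g <# H2) ` carrier G"
  define act where "act g = (\<lambda>(A, B). (g <# A, g <# B))" for g :: 'a
  have sub: "A \<subseteq> carrier G" if "A \<in> C1 \<or> A \<in> C2" for A
    using that l_coset_subset_G[OF H1] l_coset_subset_G[OF H2] unfolding C1_def C2_def by blast
  have fixed: "\<exists>h\<in>H. g = k \<otimes> h \<otimes> inv k"
    if "subgroup H G" "g \<in> carrier G" "k \<in> carrier G" "g <# (k <# H) = k <# H" for g k H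
  proof -
    have HG: "H \<subseteq> carrier G" using that(1) by (rule subgroup.subset)
    have "k \<in> k <# H" using that(3) subgroup.one_closed[OF that(1)] by (force simp: l_coset_def)
    then have "g \<otimes> k \<in> k <# H" using that(4) by (force simp: l_coset_def)
    then obtain h where h: "h \<in> H" "g \<otimes> k = k \<otimes> h" by (auto simp: l_coset_def)
    then have "g = k \<otimes> h \<otimes> inv k" using that HG by (auto simp: inv_solve_right)
    then show ?thesis using h by blast
  qed
  obtain u where u: "u \<in> C1 \<times> C2 \<rightarrow> carrier G"
    "\<And>g x. g \<in> carrier G \<Longrightarrow> x \<in> C1 \<times> C2 \<Longrightarrow> u (act g x) = g \<otimes> u x"
  proof (rule free_action_equivariant_map[of "C1 \<times> C2" act])
    show "act g x \<in> C1 \<times> C2" if "g \<in> carrier G" "x \<in> C1 \<times> C2" for g x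
      using that H1 H2 by (auto simp: act_def C1_def C2_def lcos_m_assoc)
    show "act \<one> x = x" if "x \<in> C1 \<times> C2" for x
      using that sub by (auto simp: act_def lcos_mult_one)
    show "act (g \<otimes> h) x = act g (act h x)"
      if "g \<in> carrier G" "h \<in> carrier G" "x \<in> C1 \<times> C2" for g h x
      using that sub by (auto simp: act_def lcos_m_assoc)
    fix g x assume g: "g \<in> carrier G" and x: "x \<in> C1 \<times> C2" "act g x = x"
    then obtain k1 k2 where k: "k1 \<in> carrier G" "k2 \<in> carrier G" "x = (k1 <# H1, k2 <# H2)"
      by (auto simp: C1_def C2_def)
    obtain h1 where h1: "h1 \<in> H1" "g = k1 \<otimes> h1 \<otimes> inv k1"
      using fixed[OF K1.subgroup_H g k(1)] x(2) k(3) by (auto simp: act_def)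
    obtain h2 where h2: "h2 \<in> H2" "g = k2 \<otimes> h2 \<otimes> inv k2"
      using fixed[OF K2.subgroup_H g k(2)] x(2) k(3) by (auto simp: act_def)
    have G: "h1 \<in> carrier G" "h2 \<in> carrier G" using h1 h2 H1 H2 by auto
    \<comment> \<open>An element g fixing both cosets is a conjugate of \<open>h1\<close> and of
      \<open>h2\<close>; moving \<open>k2\<close> to the other side shows a conjugate of
      \<open>h1\<close> in H2, the form required by \<open>disj\<close>.\<close>
    have "(inv k2 \<otimes> k1) \<otimes> h1 \<otimes> inv (inv k2 \<otimes> k1) = inv k2 \<otimes> (k1 \<otimes> h1 \<otimes> inv k1) \<otimes> k2"
      using k G by (simp add: m_assoc inv_mult_group)
    also have "\<dots> = h2"
      unfolding h1(2)[symmetric] h2(2) using k G by (simp add: m_assoc inv_cancel)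
    finally have "h1 = \<one>" using disj[of "inv k2 \<otimes> k1" h1] k h1(1) h2(1) by simp
    then show "g = \<one>" using h1 k by simp
  qed blast
  let ?X = "prod_topology (realization S1) (realization S2)"
  define f where "f = (\<lambda>(x, y). u (K1.coset_of x, K2.coset_of y))"
  have "continuous_map ?X (discrete_topology (C1 \<times> C2)) (\<lambda>z. ((K1.coset_of \<circ> fst) z, (K2.coset_of \<circ> snd) z))"
    unfolding prod_topology_discrete_topology C1_def C2_def S1_def S2_def
    by (intro continuous_map_pairedI continuous_map_compose[OF continuous_map_fst]
        continuous_map_compose[OF continuous_map_snd] K1.continuous_map_coset_of K2.continuous_map_coset_of)
  moreover have "continuous_map (discrete_topology (C1 \<times> C2)) (discrete_topology (carrier G)) u"
    using u(1) by (simp add: continuous_map_from_discrete_topology)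
  ultimately have "continuous_map ?X (discrete_topology (carrier G))
      (u \<circ> (\<lambda>z. ((K1.coset_of \<circ> fst) z, (K2.coset_of \<circ> snd) z)))"
    by (rule continuous_map_compose)
  then have cont: "continuous_map ?X (discrete_topology (carrier G)) f"
    by (simp add: f_def o_def case_prod_unfold)
  have "f (diagonal_action (realization_action S1 \<phi>1) (realization_action S2 \<phi>2) g z) = g \<otimes> f z"
    if g: "g \<in> carrier G" and z: "z \<in> topspace ?X" for g z
  proof -
    obtain x y where xy: "z = (x, y)" "x \<in> realization_points S1" "y \<in> realization_points S2"
      using z by auto
    have "(K1.coset_of x, K2.coset_of y) \<in> C1 \<times> C2"
      using continuous_map_funspace[OF K1.continuous_map_coset_of]
        continuous_map_funspace[OF K2.continuous_map_coset_of] xy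
      by (auto simp: C1_def C2_def S1_def S2_def Pi_iff)
    from u(2)[OF g this] show ?thesis
      using g xy by (simp add: f_def diagonal_action_def act_def S1_def S2_def \<phi>1_def \<phi>2_def
          K1.coset_of_action K2.coset_of_action)
  qed
  then show "\<exists>f. equivariant_map G ?X
      (diagonal_action (realization_action S1 \<phi>1) (realization_action S2 \<phi>2)) (E_space G 0) (E_action G) f"
    unfolding equivariant_map_E_space_0_iff[OF is_group] using cont by blast
qed

theorem theorem1p4:
  fixes G :: "('a, 'b) monoid_scheme"
  assumes "group G" and "finite (carrier G)" and "carrier G \<noteq> {\<one>\<^bsub>G\<^esub>}"
    and "\<not> nice_group G"
  shows "\<exists>(K\<^sub>1 :: nat set set) \<phi>\<^sub>1 (K\<^sub>2 :: nat set set) \<phi>\<^sub>2.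
    finite_free_complex G K\<^sub>1 \<phi>\<^sub>1 \<and>
    finite_free_complex G K\<^sub>2 \<phi>\<^sub>2 \<and>
    mapping_index G (realization K\<^sub>1) (realization_action K\<^sub>1 \<phi>\<^sub>1) = 1 \<and>
    mapping_index G (realization K\<^sub>2) (realization_action K\<^sub>2 \<phi>\<^sub>2) = 1 \<and>
    mapping_index G (prod_topology (realization K\<^sub>1) (realization K\<^sub>2))
      (diagonal_action (realization_action K\<^sub>1 \<phi>\<^sub>1) (realization_action K\<^sub>2 \<phi>\<^sub>2)) = 0"
proof -
  interpret group G by (rule assms(1))
  obtain H1 H2 where H: "subgroup H1 G" "H1 \<noteq> {\<one>\<^bsub>G\<^esub>}" "subgroup H2 G" "H2 \<noteq> {\<one>\<^bsub>G\<^esub>}"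
    and disj: "\<And>g h. g \<in> carrier G \<Longrightarrow> h \<in> H1 \<Longrightarrow> g \<otimes>\<^bsub>G\<^esub> h \<otimes>\<^bsub>G\<^esub> inv\<^bsub>G\<^esub> g \<in> H2 \<Longrightarrow> h = \<one>\<^bsub>G\<^esub>"
    by (rule not_nice_imp_conjugate_disjoint_subgroups[OF assms(2-4)]) (rule that)
  \<comment> \<open>One numbering of the coloured vertices by natural numbers serves both graphs,
    which have the same vertices and differ only in their edges.\<close>
  have "finite (carrier G \<times> (UNIV :: bool set))" using assms(2) by simp
  then obtain e :: "'a \<times> bool \<Rightarrow> nat" where e: "inj_on e (carrier G \<times> UNIV)"
    by (metis finite_imp_inj_to_nat_seg)
  have K: "coset_graph G H1 e" "coset_graph G H2 e"
    using assms(1,2) H e by (simp_all add: coset_graph_def coset_graph_axioms_def)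
  show ?thesis
  proof (intro exI conjI)
    show "finite_free_complex G (coset_graph.simplices G H1 e) (coset_graph.act G e)"
      by (rule coset_graph.finite_free_complex_simplices[OF K(1)])
    show "finite_free_complex G (coset_graph.simplices G H2 e) (coset_graph.act G e)"
      by (rule coset_graph.finite_free_complex_simplices[OF K(2)])
  qed (rule coset_graph.mapping_index_realization[OF K(1) H(2)]
      coset_graph.mapping_index_realization[OF K(2) H(4)]
      mapping_index_product_coset_graphs[OF K disj]; assumption)+
qed

end
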